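(* Let $G$ be a graph of maximum degree $\Delta$, let $\lambda>0$ and let $(\beta_u,\gamma_u)_{u\in V(G)}$ be pairs of positive reals such that the hard-core model on $G$ at fugacity $\lambda$ has local $(\beta_u,\gamma_u)_u$-occupancy. Let $(\ell_u,\eta_u)_{u\in V(G)}$ be pairs of positive reals with $\eta_u<1$ for all $u$, and let $\mathscr H=(L,H)$ be a cover of $G$ that arises from a list-assignment of $G$ and satisfies, for all $u\in V(G)$, \[ \frac{1+\lambda}{\beta_u\lambda}\bigl(|L(u)|-\gamma_u\deg(u)\bigr)\ \ge\ \max\Bigl\{\frac{\ell_u}{1-\eta_u},\ \frac{6\log(2\Delta)}{\eta_u^2}\Bigr\}, \] and $Z_F(\lambda)\ge 8|L(u)|\Delta^3$ for every induced subgraph $F$ of $G[N(u)]$ on more than $\ell_u^*:=\min_{v\in N(u)}\ell_v/8$ vertices. Then $G$ admits an $\mathscr H$-colouring. Moreover, if the hard-core model on $G$ at fugacity $\lambda$ has strong local $(\beta_u,\gamma_u)_u$-occupancy, the same conclusion holds for every cover $\mathscr H$ satisfying these conditions, whether or not it arises from a list-assignment.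
   Context: All graphs are finite and simple; $\log$ is the natural logarithm. For a graph $G$, $\mathcal I(G)$ denotes the set of independent sets (including $\varnothing$), and $Z_G(\lambda)=\sum_{I\in\mathcal I(G)}\lambda^{|I|}$, with $Z_G'$ its derivative in $\lambda$. The hard-core model on $G$ at fugacity $\lambda>0$ is the distribution on $\mathcal I(G)$ with $\Pr(\mathbf I=I)=\lambda^{|I|}/Z_G(\lambda)$. Given $\lambda>0$ and positive reals $(\beta_u,\gamma_u)$ for $u\in V(G)$, the hard-core model on $G$ at fugacity $\lambda$ has local $(\beta_u,\gamma_u)_u$-occupancy if for every $u\in V(G)$ and every induced subgraph $F$ of $G[N(u)]$ (including the graph with no vertices, for which $Z_F=1$, $Z_F'=0$), \[\beta_u\frac{\lambda}{1+\lambda}\frac{1}{Z_F(\lambda)}+\gamma_u\frac{\lambda Z_F'(\lambda)}{Z_F(\lambda)}\ge 1;\] it has strong local $(\beta_u,\gamma_u)_u$-occupancy if this holds for every (not necessarily induced) subgraph $F$ of $G[N(u)]$. A cover of $G$ is a pair $\mathscr H=(L,H)$ where $H$ is a graph and $L:V(G)\to 2^{V(H)}$ is such that: the sets $L(u)$, $u\in V(G)$, partition $V(H)$; each $H[L(u)]$ is complete; if there is an edge of $H$ between $L(u)$ and $L(v)$ with $u\ne v$ then $uv\in E(G)$; and for $uv\in E(G)$ the edges of $H$ between $L(u)$ and $L(v)$ form a (possibly empty) matching. An $\mathscr H$-colouring of $G$ is an independent set of $H$ of size $|V(G)|$. A cover arises from a list-assignment if there are finite sets $S(u)\subset\mathbb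 Z^+$ such that, up to isomorphism, $L(u)=\{(u,c):c\in S(u)\}$ and for $u\neq v$, $(u,c)(v,c')\in E(H)$ iff $uv\in E(G)$ and $c=c'$. *)

theory Defs
  imports Complex_Main
begin

definition graph :: "'a set \<Rightarrow> 'a set set \<Rightarrow> bool" where
  "graph V E \<longleftrightarrow> finite V \<and> (\<forall>e\<in>E. \<exists>u v. e = {u, v} \<and> u \<noteq> v \<and> u \<in> V \<and> v \<in> V)"

definition nbhd :: "'a set \<Rightarrow> 'a set set \<Rightarrow> 'a \<Rightarrow> 'a set" where
  "nbhd V E u = {v \<in> V. {u, v} \<in> E}"

definition degree :: "'a set \<Rightarrow> 'a set set \<Rightarrow> 'a \<Rightarrow> nat" where
  "degree V E u = card (nbhd V E u)"

definition max_degree :: "'a set \<Rightarrow> 'a set set \<Rightarrow> nat" where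
  "max_degree V E = Max (insert 0 (degree V E ` V))"

definition indep :: "'a set \<Rightarrow> 'a set set \<Rightarrow> 'a set \<Rightarrow> bool" where
  "indep V E I \<longleftrightarrow> I \<subseteq> V \<and> (\<forall>u\<in>I. \<forall>v\<in>I. {u, v} \<notin> E)"

definition indep_sets :: "'a set \<Rightarrow> 'a set set \<Rightarrow> 'a set set" where
  "indep_sets V E = {I. indep V E I}"

definition Zpoly :: "'a set \<Rightarrow> 'a set set \<Rightarrow> real \<Rightarrow> real" where
  "Zpoly V E lam = (\<Sum>I\<in>indep_sets V E. lam ^ card I)"

definition Zpoly' :: "'a set \<Rightarrow> 'a set set \<Rightarrow> real \<Rightarrow> real" where
  "Zpoly' V E lam = (\<Sum>I\<in>indep_sets V E. real (card I) * lam ^ (card I - 1))"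

definition induced_edges :: "'a set set \<Rightarrow> 'a set \<Rightarrow> 'a set set" where
  "induced_edges E S = {e \<in> E. e \<subseteq> S}"

definition occ_ineq :: "real \<Rightarrow> real \<Rightarrow> real \<Rightarrow> 'a set \<Rightarrow> 'a set set \<Rightarrow> bool" where
  "occ_ineq lam b g S F \<longleftrightarrow>
     b * (lam / (1 + lam)) * (1 / Zpoly S F lam) + g * (lam * Zpoly' S F lam / Zpoly S F lam) \<ge> 1"

definition local_occupancy ::
  "'a set \<Rightarrow> 'a set set \<Rightarrow> real \<Rightarrow> ('a \<Rightarrow> real) \<Rightarrow> ('a \<Rightarrow> real) \<Rightarrow> bool" where
  "local_occupancy V E lam \<beta> \<gamma> \<longleftrightarrow>
     (\<forall>u\<in>V. \<forall>S. S \<subseteq> nbhd V E u \<longrightarrow> occ_ineq lam (\<beta> u) (\<gamma> u) S (induced_edges E S))"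

definition strong_local_occupancy ::
  "'a set \<Rightarrow> 'a set set \<Rightarrow> real \<Rightarrow> ('a \<Rightarrow> real) \<Rightarrow> ('a \<Rightarrow> real) \<Rightarrow> bool" where
  "strong_local_occupancy V E lam \<beta> \<gamma> \<longleftrightarrow>
     (\<forall>u\<in>V. \<forall>S F. S \<subseteq> nbhd V E u \<longrightarrow> F \<subseteq> induced_edges E S \<longrightarrow> occ_ineq lam (\<beta> u) (\<gamma> u) S F)"

definition is_cover ::
  "'a set \<Rightarrow> 'a set set \<Rightarrow> ('a \<Rightarrow> 'c set) \<Rightarrow> 'c set \<Rightarrow> 'c set set \<Rightarrow> bool" where
  "is_cover V E L VH EH \<longleftrightarrow>
     graph VH EH \<and>
     (\<Union>u\<in>V. L u) = VH \<and>
     (\<forall>u\<in>V. \<forall>v\<in>V. u \<noteq> v \<longrightarrow> L u \<inter> L v = {}) \<and>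
     (\<forall>u\<in>V. \<forall>x\<in>L u. \<forall>y\<in>L u. x \<noteq> y \<longrightarrow> {x, y} \<in> EH) \<and>
     (\<forall>u\<in>V. \<forall>v\<in>V. u \<noteq> v \<longrightarrow> (\<exists>x\<in>L u. \<exists>y\<in>L v. {x, y} \<in> EH) \<longrightarrow> {u, v} \<in> E) \<and>
     (\<forall>u\<in>V. \<forall>v\<in>V. {u, v} \<in> E \<longrightarrow>
        (\<forall>x\<in>L u. \<forall>y\<in>L v. \<forall>y'\<in>L v. {x, y} \<in> EH \<longrightarrow> {x, y'} \<in> EH \<longrightarrow> y = y') \<and>
        (\<forall>y\<in>L v. \<forall>x\<in>L u. \<forall>x'\<in>L u. {x, y} \<in> EH \<longrightarrow> {x', y} \<in> EH \<longrightarrow> x = x'))"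

text \<open>The cover arises from a list-assignment S (lists of positive integers), up to isomorphism.\<close>
definition arises_from_lists ::
  "'a set \<Rightarrow> 'a set set \<Rightarrow> ('a \<Rightarrow> 'c set) \<Rightarrow> 'c set \<Rightarrow> 'c set set \<Rightarrow> bool" where
  "arises_from_lists V E L VH EH \<longleftrightarrow>
     (\<exists>(S :: 'a \<Rightarrow> nat set) (\<phi> :: 'c \<Rightarrow> 'a \<times> nat).
        (\<forall>u\<in>V. finite (S u) \<and> 0 \<notin> S u) \<and>
        bij_betw \<phi> VH (SIGMA u:V. S u) \<and>
        (\<forall>u\<in>V. \<phi> ` L u = {u} \<times> S u) \<and>
        (\<forall>x\<in>VH. \<forall>y\<in>VH. fst (\<phi> x) \<noteq> fst (\<phi> y) \<longrightarrow>
           ({x, y} \<in> EH \<longleftrightarrow> {fst (\<phi> x), fst (\<phi> y)} \<in> E \<and> snd (\<phi> x) = snd (\<phi> y))))"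

definition has_cover_colouring ::
  "'a set \<Rightarrow> ('a \<Rightarrow> 'c set) \<Rightarrow> 'c set \<Rightarrow> 'c set set \<Rightarrow> bool" where
  "has_cover_colouring V L VH EH \<longleftrightarrow> (\<exists>I. indep VH EH I \<and> card I = card V)"

end

theory Submission
  imports Defs "HOL-Library.FuncSet"
begin

text \<open>
  Draw \<open>I\<close> from the hard-core model on the cover graph \<open>H\<close> and condition on \<open>I\<close> outside the lists of
  \<open>N(u)\<close>. Given \<open>I\<close> outside the neighbourhood of a colour \<open>x \<in> L u\<close>, the part inside is a hard-core
  model on a copy of a subgraph of \<open>G[N(u)]\<close>, so occupancy bounds the expected number of free colours
  at \<open>u\<close> below by \<open>\<mu> = (1 + \<lambda>) / (\<beta> \<lambda>) (|L u| - \<gamma> deg u)\<close>. The events that \<open>x\<close> is free need not be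
  negatively correlated for different \<open>x\<close>, so concentration is obtained by tilting instead: with
  \<open>\<phi> t = \<Sum>\<^sub>I \<lambda>^|I| t^X(I)\<close>, \<open>X\<close> the number of free colours, occupancy yields \<open>\<phi>' \<ge> \<mu> \<phi>\<close> on
  \<open>(0, 1]\<close>, hence exactly the Chernoff bound on the moment generating function of \<open>X\<close>. The assumption
  on \<open>Z\<^sub>F\<close> bounds the probability that a free colour has many free neighbours. The lopsided local
  lemma gives an \<open>I\<close> for which neither failure occurs at any uncoloured vertex, and a second
  application of the local lemma extends \<open>I\<close> by a random choice of free colours.
\<close>

subsection \<open>The lopsided local lemma\<close>

lemma sum_UN_le:
  fixes f :: "_ \<Rightarrow> real"
  assumes "finite I" "\<And>i. i \<in> I \<Longrightarrow> finite (A i)"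
    and "\<And>i a. i \<in> I \<Longrightarrow> a \<in> A i \<Longrightarrow> 0 \<le> f a"
  shows "sum f (\<Union>i\<in>I. A i) \<le> (\<Sum>i\<in>I. sum f (A i))"
  using assms
proof (induction I rule: finite_induct)
  case (insert i I)
  have "sum f (A i \<union> (\<Union>j\<in>I. A j)) \<le> sum f (A i) + sum f (\<Union>j\<in>I. A j)"
    using insert.prems insert.hyps
    by (subst sum.union_inter [symmetric]) (auto intro!: sum_nonneg)
  with insert show ?case by fastforce
qed simp

text \<open>Unnormalised weights stand in for probabilities, so nothing is divided by a conditional
  probability. Induction on the size of \<open>S\<close> shows that, given that no event of
  \<open>S\<close> occurs, event \<open>i\<close> has conditional probability at most
  \<open>2 * p i\<close>: conditioning on the events in \<open>\<Gamma> i\<close> costs at most a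
  factor 2.\<close>

lemma lopsided_local_lemma:
  fixes w p :: "_ \<Rightarrow> real"
  assumes fin: "finite \<Omega>" "finite N"
    and w: "\<And>a. a \<in> \<Omega> \<Longrightarrow> 0 \<le> w a" and tot: "0 < sum w \<Omega>"
    and p: "\<And>i. i \<in> N \<Longrightarrow> 0 \<le> p i \<and> p i \<le> 1 / 4"
    and \<Gamma>: "\<And>i. i \<in> N \<Longrightarrow> sum p (N \<inter> \<Gamma> i) \<le> 1 / 4"
    and lop: "\<And>i S. i \<in> N \<Longrightarrow> S \<subseteq> N - \<Gamma> i \<Longrightarrow> i \<notin> S \<Longrightarrow>
      sum w {a \<in> \<Omega>. B i a \<and> (\<forall>j\<in>S. \<not> B j a)} \<le> p i * sum w {a \<in> \<Omega>. \<forall>j\<in>S. \<not> B j a}"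
  shows "\<exists>a\<in>\<Omega>. \<forall>i\<in>N. \<not> B i a"
proof -
  define m where "m S = sum w {a \<in> \<Omega>. \<forall>j\<in>S. \<not> B j a}" for S
  define b where "b i S = sum w {a \<in> \<Omega>. B i a \<and> (\<forall>j\<in>S. \<not> B j a)}" for i S
  have m_nn: "0 \<le> m S" for S
    unfolding m_def by (intro sum_nonneg) (auto intro: w)
  have key: "0 < m S \<and> (\<forall>i\<in>N. b i S \<le> 2 * p i * m S)" if "S \<subseteq> N" "card S = n" for S n
    using that
  proof (induction n arbitrary: S rule: less_induct)
    case (less n)
    have finS: "finite S" using less.prems fin finite_subset by blast
    have pos: "0 < m S"
    proof (cases "S = {}")
      case True then show ?thesis using tot by (simp add: m_def)
    next
      case False
      then obtain j where j: "j \<in> S" by blast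
      have eq: "m (S - {j}) = m S + b j (S - {j})"
        unfolding m_def b_def using fin j
        by (subst sum.union_disjoint [symmetric]) (auto intro!: sum.cong)
      have c: "card (S - {j}) < n" using j finS less.prems by (metis card_Diff1_less)
      have IH: "0 < m (S - {j})" "b j (S - {j}) \<le> 2 * p j * m (S - {j})"
        using less.IH [OF c, of "S - {j}"] less.prems j by auto
      \<comment> \<open>Since \<open>p j\<close> is at most 1/4, avoiding \<open>j\<close> as well
        keeps at least half of the weight.\<close>
      have "p j * m (S - {j}) \<le> 1 / 4 * m (S - {j})"
        using p j less.prems IH by (intro mult_right_mono) auto
      then show ?thesis using eq IH by linarith
    qed
    moreover have "b i S \<le> 2 * p i * m S" if i: "i \<in> N" for i
    proof (cases "i \<in> S")
      case True
      then have "{a \<in> \<Omega>. B i a \<and> (\<forall>j\<in>S. \<not> B j a)} = {}" by auto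
      then have "b i S = 0" unfolding b_def by (metis sum.empty)
      then show ?thesis using p [OF i] m_nn [of S] by simp
    next
      case False
      define T where "T = S - \<Gamma> i"
      define S1 where "S1 = S \<inter> \<Gamma> i"
      \<comment> \<open>Union bound over \<open>S1\<close>: passing from \<open>T\<close> to
        \<open>S\<close> loses at most \<open>2 * (1 / 4) * m T\<close>.\<close>
      have half: "m T / 2 \<le> m S"
      proof (cases "S1 = {}")
        case True
        then have "T = S" by (auto simp: T_def S1_def)
        then show ?thesis using m_nn [of S] by simp
      next
        case False
        then have "T \<subset> S" by (auto simp: T_def S1_def)
        then have c: "card T < n" using finS less.prems psubset_card_mono by blast
        have IH: "b j T \<le> 2 * p j * m T" if "j \<in> N" for j
          using less.IH [OF c, of T] less.prems that by (auto simp: T_def)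
        have "m T \<le> sum w ({a \<in> \<Omega>. \<forall>j\<in>S. \<not> B j a} \<union> (\<Union>j\<in>S1. {a \<in> \<Omega>. B j a \<and> (\<forall>k\<in>T. \<not> B k a)}))"
          unfolding m_def using fin finS
          by (intro sum_mono2) (auto simp: T_def S1_def intro: w)
        also have "\<dots> \<le> m S + sum w (\<Union>j\<in>S1. {a \<in> \<Omega>. B j a \<and> (\<forall>k\<in>T. \<not> B k a)})"
          unfolding m_def using fin finS
          by (subst sum.union_inter [symmetric])
             (auto simp: S1_def intro!: sum_nonneg w)
        also have "sum w (\<Union>j\<in>S1. {a \<in> \<Omega>. B j a \<and> (\<forall>k\<in>T. \<not> B k a)}) \<le> (\<Sum>j\<in>S1. b j T)"
          unfolding b_def using fin finS
          by (intro sum_UN_le) (auto simp: S1_def intro: w)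
        also have "\<dots> \<le> (\<Sum>j\<in>S1. 2 * p j * m T)"
          using less.prems by (intro sum_mono IH) (auto simp: S1_def)
        also have "\<dots> = 2 * m T * sum p S1" by (simp add: sum_distrib_left sum_distrib_right mult_ac)
        also have "sum p S1 \<le> sum p (N \<inter> \<Gamma> i)"
          using fin less.prems p by (intro sum_mono2) (auto simp: S1_def)
        also have "\<dots> \<le> 1 / 4" by (rule \<Gamma> [OF i])
        finally show ?thesis using m_nn [of T] by (simp add: mult_left_mono)
      qed
      have "b i S \<le> b i T"
        unfolding b_def using fin by (intro sum_mono2) (auto simp: T_def intro: w)
      also have "\<dots> \<le> p i * m T"
        unfolding b_def m_def using False i less.prems by (intro lop) (auto simp: T_def)
      also have "\<dots> \<le> p i * (2 * m S)" using half p [OF i] by (intro mult_left_mono) auto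
      finally show ?thesis by simp
    qed
    ultimately show ?case by blast
  qed
  have "m N \<noteq> 0" using key [of N] by force
  then have "{a \<in> \<Omega>. \<forall>j\<in>N. \<not> B j a} \<noteq> {}" unfolding m_def by (metis sum.empty)
  then show ?thesis by blast
qed

subsection \<open>Hard-core models with occupancy\<close>

text \<open>The part of \<open>C\<close> left open when an independent set equals \<open>R\<close>
  outside \<open>C\<close>: given \<open>R\<close>, its part inside \<open>C\<close> is an arbitrary
  independent set of open vertices.\<close>

definition avail :: "'a set set \<Rightarrow> 'a set \<Rightarrow> 'a set \<Rightarrow> 'a set" where
  "avail E C R = {y \<in> C. \<forall>z\<in>R. {y, z} \<notin> E}"

lemma finite_indep_sets [simp]: "finite K \<Longrightarrow> finite (indep_sets K E)"
  by (rule finite_subset [of _ "Pow K"]) (auto simp: indep_sets_def indep_def)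

lemma empty_in_indep_sets [simp]: "{} \<in> indep_sets K E"
  by (simp add: indep_sets_def indep_def)

lemma indep_setsD: "A \<in> indep_sets K E \<Longrightarrow> A \<subseteq> K"
  by (simp add: indep_sets_def indep_def)

text \<open>The spatial Markov property of the hard-core model in summed form, via \<open>A\<close>
  and the pair \<open>(A - C, A \<inter> C)\<close>. It replaces conditioning on the configuration
  outside \<open>C\<close>.\<close>

lemma sum_indep_sets_split:
  assumes "C \<subseteq> K" "finite K"
  shows "(\<Sum>A\<in>indep_sets K E. f A) =
    (\<Sum>R\<in>indep_sets (K - C) E. \<Sum>Q\<in>indep_sets (avail E C R) E. f (R \<union> Q))"
proof -
  have fin: "finite (avail E C R)" for R
    using assms by (auto simp: avail_def intro: finite_subset)
  have d: "R \<inter> C = {}" "Q \<subseteq> C"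
    if "R \<in> indep_sets (K - C) E" "Q \<in> indep_sets (avail E C R) E" for R Q
    using that by (auto simp: indep_sets_def indep_def avail_def)
  have union: "R \<union> Q \<in> indep_sets K E"
    if R: "R \<in> indep_sets (K - C) E" and Q: "Q \<in> indep_sets (avail E C R) E" for R Q
  proof -
    have "{y, z} \<notin> E" "{z, y} \<notin> E" if "y \<in> Q" "z \<in> R" for y z
      using that Q by (auto simp: indep_sets_def indep_def avail_def insert_commute)
    then show ?thesis
      using d [OF R Q] R Q assms unfolding indep_sets_def indep_def mem_Collect_eq by blast
  qed
  have "(\<Sum>A\<in>indep_sets K E. f A) =
      (\<Sum>(R, Q)\<in>(SIGMA R:indep_sets (K - C) E. indep_sets (avail E C R) E). f (R \<union> Q))"
  proof (rule sum.reindex_bij_witness [where j = "\<lambda>A. (A - C, A \<inter> C)" and i = "\<lambda>(R, Q). R \<union> Q"], goal_cases)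
    case (2 A)
    then show ?case by (auto simp: indep_sets_def indep_def avail_def)
  next
    case (3 b)
    then show ?case using d [of "fst b" "snd b"] by (cases b) auto
  next
    case (4 b)
    then show ?case using union by auto
  qed (auto simp: Un_Diff_Int)
  also have "\<dots> = (\<Sum>R\<in>indep_sets (K - C) E. \<Sum>Q\<in>indep_sets (avail E C R) E. f (R \<union> Q))"
    by (rule sum.Sigma [symmetric]) (use assms fin in auto)
  finally show ?thesis .
qed

lemma Zpoly_pos: "finite K \<Longrightarrow> lam > 0 \<Longrightarrow> Zpoly K E lam > 0"
  unfolding Zpoly_def
  by (rule sum_pos2 [where i = "{}"]) auto

lemma sum_indicator_empty:
  assumes "finite K"
  shows "(\<Sum>Q\<in>indep_sets K E. if Q = {} then f Q else 0) = (f {} :: real)"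
  using assms by (simp add: sum.delta)

text \<open>\<open>N A\<close> counts the classes missed by \<open>A\<close>, and the inequality
  concerns its generating function in \<open>t\<close>. Fix \<open>x\<close> and the part
  \<open>R\<close> of \<open>A\<close> outside \<open>C x\<close>. In the occupancy bound the
  \<open>\<alpha>\<close> term is the weight of leaving \<open>C x\<close> empty, the
  \<open>\<gamma>\<close> term the weighted size of the part in \<open>C x\<close>. Summed over
  \<open>x\<close>, the first gives the derivative, the second at most \<open>d\<close> times the
  function.\<close>

lemma occupancy_differential_inequality:
  fixes lam \<alpha> \<gamma> t :: real and C :: "'x \<Rightarrow> 'c set"
  assumes K: "finite K" and X: "finite X"
    and C: "\<And>x. x \<in> X \<Longrightarrow> C x \<subseteq> K"
    and disj: "\<And>x y. x \<in> X \<Longrightarrow> y \<in> X \<Longrightarrow> x \<noteq> y \<Longrightarrow> C x \<inter> C y = {}"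
    and lam: "lam > 0" and \<gamma>: "\<gamma> \<ge> 0" and t: "0 < t" "t \<le> 1"
    and occ: "\<And>x R. x \<in> X \<Longrightarrow> R \<subseteq> C x \<Longrightarrow>
      Zpoly R E lam \<le> \<alpha> + \<gamma> * (lam * Zpoly' R E lam)"
    and d: "\<And>A. A \<in> indep_sets K E \<Longrightarrow> card A \<le> d"
    and N: "\<And>A. N A = card {x \<in> X. C x \<inter> A = {}}"
  shows "(real (card X) - \<gamma> * real d) * (\<Sum>A\<in>indep_sets K E. lam ^ card A * t ^ N A)
    \<le> \<alpha> * (\<Sum>A\<in>indep_sets K E. lam ^ card A * (real (N A) * t ^ (N A - 1)))"
proof -
  let ?I = "indep_sets K E"
  have one: "(\<Sum>A\<in>?I. lam ^ card A * t ^ N A)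
      \<le> \<alpha> * (\<Sum>A\<in>?I. if C x \<inter> A = {} then lam ^ card A * t ^ (N A - 1) else 0)
        + \<gamma> * (\<Sum>A\<in>?I. real (card (C x \<inter> A)) * (lam ^ card A * t ^ N A))"
    if x: "x \<in> X" for x
  proof -
    \<comment> \<open>The classes other than \<open>C x\<close> missed by \<open>R\<close>; by
      disjointness a part \<open>Q\<close> inside \<open>C x\<close> does not change this
      number.\<close>
    define n where "n R = card {y \<in> X - {x}. C y \<inter> R = {}}" for R
    let ?av = "avail E (C x)"
    have "(\<Sum>Q\<in>indep_sets (?av R) E. lam ^ card (R \<union> Q) * t ^ N (R \<union> Q))
      \<le> \<alpha> * (\<Sum>Q\<in>indep_sets (?av R) E. if C x \<inter> (R \<union> Q) = {}
            then lam ^ card (R \<union> Q) * t ^ (N (R \<union> Q) - 1) else 0)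
        + \<gamma> * (\<Sum>Q\<in>indep_sets (?av R) E. real (card (C x \<inter> (R \<union> Q))) * (lam ^ card (R \<union> Q) * t ^ N (R \<union> Q)))"
      if R: "R \<in> indep_sets (K - C x) E" for R
    proof -
      let ?w = "lam ^ card R * t ^ n R"
      have finC: "finite (C x)" using C [OF x] K finite_subset by blast
      then have finav: "finite (?av R)" by (simp add: avail_def)
      have RC: "R \<subseteq> K - C x" using R by (rule indep_setsD)
      then have finR: "finite R" using K finite_subset by blast
      have w: "?w > 0" using lam t by simp
      have Q: "Q \<subseteq> C x" "finite Q" "C x \<inter> (R \<union> Q) = Q" "card (R \<union> Q) = card R + card Q"
          "N (R \<union> Q) = n R + (if Q = {} then 1 else 0)"
        if "Q \<in> indep_sets (?av R) E" for Q
      proof -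
        show 1: "Q \<subseteq> C x" using indep_setsD [OF that] by (auto simp: avail_def)
        then show 2: "finite Q" using finC finite_subset by blast
        show "C x \<inter> (R \<union> Q) = Q" using 1 RC by auto
        show "card (R \<union> Q) = card R + card Q"
          using 1 2 finR RC by (intro card_Un_disjoint) auto
        have "C y \<inter> (R \<union> Q) = C y \<inter> R" if "y \<in> X - {x}" for y
          using 1 disj [of x y] that x by auto
        then have "{y \<in> X. C y \<inter> (R \<union> Q) = {}} =
            {y \<in> X - {x}. C y \<inter> R = {}} \<union> (if Q = {} then {x} else {})"
          using x 1 RC by (auto split: if_splits)
        then show "N (R \<union> Q) = n R + (if Q = {} then 1 else 0)"
          unfolding N n_def using X by (simp add: card_insert_if)
      qed
      \<comment> \<open>The empty \<open>Q\<close> carries an extra factor \<open>t\<close>;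
        dropping it is an upper bound because \<open>t \<le> 1\<close>.\<close>
      have "(\<Sum>Q\<in>indep_sets (?av R) E. lam ^ card (R \<union> Q) * t ^ N (R \<union> Q))
          \<le> (\<Sum>Q\<in>indep_sets (?av R) E. ?w * lam ^ card Q)"
        using lam t by (intro sum_mono) (auto simp: Q(4,5) power_add mult_ac
            intro!: mult_left_mono mult_left_le)
      also have "\<dots> = ?w * Zpoly (?av R) E lam"
        by (simp add: Zpoly_def sum_distrib_left)
      also have "\<dots> \<le> ?w * (\<alpha> + \<gamma> * (lam * Zpoly' (?av R) E lam))"
        using w by (intro mult_left_mono occ [OF x]) (auto simp: avail_def)
      also have "\<dots> = \<alpha> * ?w + \<gamma> * (?w * (lam * Zpoly' (?av R) E lam))"
        by (simp add: algebra_simps)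
      finally have le: "(\<Sum>Q\<in>indep_sets (?av R) E. lam ^ card (R \<union> Q) * t ^ N (R \<union> Q))
          \<le> \<alpha> * ?w + \<gamma> * (?w * (lam * Zpoly' (?av R) E lam))" .
      \<comment> \<open>Only \<open>Q = {}\<close> misses \<open>C x\<close>; its count is
        \<open>n R + 1\<close>, so the exponent \<open>N - 1\<close> of the derivative is exactly
        \<open>n R\<close>.\<close>
      have empty: "?w = (\<Sum>Q\<in>indep_sets (?av R) E. if C x \<inter> (R \<union> Q) = {}
            then lam ^ card (R \<union> Q) * t ^ (N (R \<union> Q) - 1) else 0)"
      proof -
        have "?w = (\<Sum>Q\<in>indep_sets (?av R) E. if Q = {} then ?w else 0)"
          using finav by (simp add: sum_indicator_empty)
        also have "\<dots> = (\<Sum>Q\<in>indep_sets (?av R) E. if C x \<inter> (R \<union> Q) = {}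
            then lam ^ card (R \<union> Q) * t ^ (N (R \<union> Q) - 1) else 0)"
          by (intro sum.cong) (auto simp: Q(3) Q(5) [of "{}", simplified])
        finally show ?thesis .
      qed
      \<comment> \<open>The empty set contributes zero to both sides, and every other
        \<open>Q\<close> has count exactly \<open>n R\<close>, so equality holds.\<close>
      have size: "?w * (lam * Zpoly' (?av R) E lam) =
          (\<Sum>Q\<in>indep_sets (?av R) E. real (card (C x \<inter> (R \<union> Q))) * (lam ^ card (R \<union> Q) * t ^ N (R \<union> Q)))"
        unfolding Zpoly'_def sum_distrib_left
      proof (intro sum.cong refl)
        fix A assume A: "A \<in> indep_sets (?av R) E"
        show "?w * (lam * (real (card A) * lam ^ (card A - 1))) =
            real (card (C x \<inter> (R \<union> A))) * (lam ^ card (R \<union> A) * t ^ N (R \<union> A))"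
          by (cases "A = {}"; cases "card A") (use Q [OF A] in \<open>simp_all add: power_add\<close>)
      qed
      show ?thesis using le unfolding size unfolding empty .
    qed
    from sum_mono [OF this] show ?thesis
      unfolding sum_indep_sets_split [OF C [OF x] K] sum.distrib sum_distrib_left [symmetric] .
  qed
  have "real (card X) * (\<Sum>A\<in>?I. lam ^ card A * t ^ N A)
      = (\<Sum>x\<in>X. \<Sum>A\<in>?I. lam ^ card A * t ^ N A)" by simp
  also have "\<dots> \<le> (\<Sum>x\<in>X. \<alpha> * (\<Sum>A\<in>?I. if C x \<inter> A = {} then lam ^ card A * t ^ (N A - 1) else 0)
        + \<gamma> * (\<Sum>A\<in>?I. real (card (C x \<inter> A)) * (lam ^ card A * t ^ N A)))"
    by (intro sum_mono one)
  also have "\<dots> = \<alpha> * (\<Sum>A\<in>?I. \<Sum>x\<in>X. if C x \<inter> A = {} then lam ^ card A * t ^ (N A - 1) else 0)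
        + \<gamma> * (\<Sum>A\<in>?I. \<Sum>x\<in>X. real (card (C x \<inter> A)) * (lam ^ card A * t ^ N A))"
    unfolding sum.distrib sum_distrib_left [symmetric]
    by (subst (1 2) sum.swap) simp
  also have "(\<Sum>A\<in>?I. \<Sum>x\<in>X. if C x \<inter> A = {} then lam ^ card A * t ^ (N A - 1) else 0)
      = (\<Sum>A\<in>?I. lam ^ card A * (real (N A) * t ^ (N A - 1)))"
    using X by (intro sum.cong refl) (simp add: sum.If_cases N Int_def mult_ac)
  \<comment> \<open>The classes are disjoint, so their parts of \<open>A\<close> have total size at
    most \<open>card A \<le> d\<close>.\<close>
  also have "(\<Sum>A\<in>?I. \<Sum>x\<in>X. real (card (C x \<inter> A)) * (lam ^ card A * t ^ N A))
      \<le> (\<Sum>A\<in>?I. real d * (lam ^ card A * t ^ N A))"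
  proof (intro sum_mono)
    fix A assume A: "A \<in> ?I"
    have finA: "finite A" using finite_subset [OF indep_setsD [OF A] K] .
    have "(\<Sum>x\<in>X. card (C x \<inter> A)) = card (\<Union>x\<in>X. C x \<inter> A)"
      using X finA disj by (intro card_UN_disjoint [symmetric]) auto
    also have "\<dots> \<le> card A" using finA by (intro card_mono) auto
    also have "\<dots> \<le> d" using d A by blast
    finally have "(\<Sum>x\<in>X. real (card (C x \<inter> A))) \<le> real d"
      by (metis of_nat_le_iff of_nat_sum)
    then show "(\<Sum>x\<in>X. real (card (C x \<inter> A)) * (lam ^ card A * t ^ N A))
        \<le> real d * (lam ^ card A * t ^ N A)"
      unfolding sum_distrib_right [symmetric] using lam t by (intro mult_right_mono) auto
  qed
  finally show ?thesis
    using \<gamma> by (simp add: left_diff_distrib mult.assoc mult_left_mono sum_distrib_left [symmetric])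
qed

section \<open>Lower tail of the number of missed classes\<close>

text \<open>Reduces the exact Chernoff exponent to a quadratic one. The difference of the sides
  vanishes at 0 and has the nonnegative derivative \<open>- ln (1 - y) - y\<close>.\<close>

lemma one_minus_mult_ln_ge:
  fixes x :: real
  assumes "0 \<le> x" "x < 1"
  shows "(1 - x) * ln (1 - x) \<ge> - x + x\<^sup>2 / 2"
proof -
  have "(1 - 0) * ln (1 - 0) + 0 - 0\<^sup>2 / 2 \<le> (1 - x) * ln (1 - x) + x - x\<^sup>2 / 2"
  proof (rule DERIV_nonneg_imp_nondecreasing [OF assms(1)])
    fix y assume y: "0 \<le> y" "y \<le> x"
    then have "((\<lambda>y. (1 - y) * ln (1 - y)) has_real_derivative - ln (1 - y) - 1) (at y)"
      using assms by (auto intro!: derivative_eq_intros simp: field_simps)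
    moreover have "((\<lambda>y. y\<^sup>2 / 2) has_real_derivative y) (at y)"
      by (auto intro!: derivative_eq_intros)
    ultimately have "((\<lambda>y. (1 - y) * ln (1 - y) + y - y\<^sup>2 / 2) has_real_derivative - ln (1 - y) - y) (at y)"
      by - (rule DERIV_cong [OF DERIV_diff [OF DERIV_add [OF _ DERIV_ident]]], assumption+, simp)
    moreover have "ln (1 - y) \<le> - y" using ln_le_minus_one [of "1 - y"] y assms by simp
    ultimately show "\<exists>z. ((\<lambda>y. (1 - y) * ln (1 - y) + y - y\<^sup>2 / 2) has_real_derivative z) (at y) \<and> 0 \<le> z"
      by force
  qed
  then show ?thesis by simp
qed

text \<open>Integrating \<open>\<phi>' \<ge> \<mu> * \<phi>\<close> from \<open>1 - \<eta>\<close>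
  to 1 bounds the generating function at \<open>1 - \<eta>\<close> in terms of
  \<open>\<phi> 1\<close>, the partition function. Markov's inequality at that point gives the
  Chernoff tail of a Poisson variable of mean \<open>\<mu>\<close>.\<close>

lemma occupancy_lower_tail:
  fixes lam \<alpha> \<gamma> \<eta> :: real and C :: "'x \<Rightarrow> 'c set"
  assumes K: "finite K" and X: "finite X"
    and C: "\<And>x. x \<in> X \<Longrightarrow> C x \<subseteq> K"
    and disj: "\<And>x y. x \<in> X \<Longrightarrow> y \<in> X \<Longrightarrow> x \<noteq> y \<Longrightarrow> C x \<inter> C y = {}"
    and lam: "lam > 0" and \<gamma>: "\<gamma> \<ge> 0" and \<alpha>: "\<alpha> > 0" and \<eta>: "0 < \<eta>" "\<eta> < 1"
    and occ: "\<And>x R. x \<in> X \<Longrightarrow> R \<subseteq> C x \<Longrightarrow>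
      Zpoly R E lam \<le> \<alpha> + \<gamma> * (lam * Zpoly' R E lam)"
    and d: "\<And>A. A \<in> indep_sets K E \<Longrightarrow> card A \<le> d"
    and \<mu>: "\<mu> = (real (card X) - \<gamma> * real d) / \<alpha>" "\<mu> \<ge> 0"
  shows "(\<Sum>A\<in>indep_sets K E.
      if real (card {x \<in> X. C x \<inter> A = {}}) \<le> (1 - \<eta>) * \<mu> then lam ^ card A else 0)
    \<le> exp (- \<eta>\<^sup>2 * \<mu> / 2) * Zpoly K E lam"
proof -
  let ?I = "indep_sets K E"
  define N where "N A = card {x \<in> X. C x \<inter> A = {}}" for A
  define \<phi> where "\<phi> t = (\<Sum>A\<in>?I. lam ^ card A * t ^ N A)" for t
  define \<phi>' where "\<phi>' t = (\<Sum>A\<in>?I. lam ^ card A * (real (N A) * t ^ (N A - 1)))" for t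
  have deriv: "(\<phi> has_real_derivative \<phi>' t) (at t)" for t
    unfolding \<phi>_def \<phi>'_def
    by (auto intro!: derivative_eq_intros sum.cong simp: mult_ac)
  \<comment> \<open>The integrating factor \<open>exp (- \<mu> * t)\<close> turns the differential
    inequality into monotonicity.\<close>
  have "\<phi> (1 - \<eta>) * exp (- \<mu> * (1 - \<eta>)) \<le> \<phi> 1 * exp (- \<mu> * 1)"
  proof (rule DERIV_nonneg_imp_nondecreasing [where f = "\<lambda>t. \<phi> t * exp (- \<mu> * t)"])
    fix t assume t: "1 - \<eta> \<le> t" "t \<le> 1"
    have "(real (card X) - \<gamma> * real d) * \<phi> t \<le> \<alpha> * \<phi>' t"
      unfolding \<phi>_def \<phi>'_def
      by (rule occupancy_differential_inequality [OF K X C disj lam \<gamma> _ _ occ d])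
         (use t \<eta> in \<open>auto simp: N_def\<close>)
    then have "\<mu> * \<phi> t \<le> \<phi>' t" using \<alpha> by (simp add: \<mu>(1) field_simps)
    then have "0 \<le> (\<phi>' t - \<mu> * \<phi> t) * exp (- \<mu> * t)" by simp
    moreover have "((\<lambda>t. \<phi> t * exp (- \<mu> * t)) has_real_derivative
        (\<phi>' t - \<mu> * \<phi> t) * exp (- \<mu> * t)) (at t)"
      by (auto intro!: derivative_eq_intros deriv simp: algebra_simps)
    ultimately show "\<exists>z. ((\<lambda>t. \<phi> t * exp (- \<mu> * t)) has_real_derivative z) (at t) \<and> 0 \<le> z"
      by blast
  qed (use \<eta> in simp)
  then have "\<phi> (1 - \<eta>) \<le> \<phi> 1 * exp (- \<mu> * 1) / exp (- \<mu> * (1 - \<eta>))"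
    by (simp only: pos_le_divide_eq exp_gt_zero)
  also have "\<dots> = \<phi> 1 * exp (- \<mu> * 1 - - \<mu> * (1 - \<eta>))"
    by (simp only: exp_diff times_divide_eq_right)
  also have "- \<mu> * 1 - - \<mu> * (1 - \<eta>) = - \<mu> * \<eta>" by (simp add: algebra_simps)
  finally have mgf: "\<phi> (1 - \<eta>) \<le> \<phi> 1 * exp (- \<mu> * \<eta>)" .
  define c where "c = (1 - \<eta>) * \<mu>"
  define S where "S = (\<Sum>A\<in>?I. if real (N A) \<le> c then lam ^ card A else 0)"
  \<comment> \<open>Markov's inequality: the base is below 1, so \<open>(1 - \<eta>) powr c\<close>
    bounds \<open>(1 - \<eta>) ^ N A\<close> from below whenever \<open>N A \<le> c\<close>. The
    threshold \<open>c\<close> need not be an integer, hence \<open>powr\<close>.\<close>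
  have "S * (1 - \<eta>) powr c = (\<Sum>A\<in>?I. if real (N A) \<le> c then lam ^ card A * (1 - \<eta>) powr c else 0)"
    by (simp add: S_def sum_distrib_right if_distrib [of "\<lambda>z. z * _"] cong: if_cong)
  also have "\<dots> \<le> \<phi> (1 - \<eta>)"
    unfolding \<phi>_def
  proof (intro sum_mono)
    fix A
    have "(1 - \<eta>) powr c \<le> (1 - \<eta>) ^ N A" if "real (N A) \<le> c"
      using \<eta> that by (simp add: powr_realpow [symmetric] powr_mono')
    then show "(if real (N A) \<le> c then lam ^ card A * (1 - \<eta>) powr c else 0)
        \<le> lam ^ card A * (1 - \<eta>) ^ N A"
      using lam \<eta> by (auto intro!: mult_left_mono)
  qed
  finally have "S * (1 - \<eta>) powr c \<le> \<phi> 1 * exp (- \<mu> * \<eta>)" using mgf by linarith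
  moreover have "(1 - \<eta>) powr c = exp (c * ln (1 - \<eta>))" using \<eta> by (simp add: powr_def)
  ultimately have "S \<le> \<phi> 1 * exp (- \<mu> * \<eta>) / exp (c * ln (1 - \<eta>))"
    by (simp add: pos_le_divide_eq)
  also have "\<dots> = exp (- \<mu> * \<eta> - c * ln (1 - \<eta>)) * \<phi> 1"
    by (simp add: exp_diff)
  also have "\<dots> \<le> exp (- \<eta>\<^sup>2 * \<mu> / 2) * \<phi> 1"
  proof (intro mult_right_mono)
    have "\<mu> * (- \<eta> + \<eta>\<^sup>2 / 2) \<le> \<mu> * ((1 - \<eta>) * ln (1 - \<eta>))"
      using one_minus_mult_ln_ge [of \<eta>] \<eta> \<mu> by (intro mult_left_mono) auto
    then show "exp (- \<mu> * \<eta> - c * ln (1 - \<eta>)) \<le> exp (- \<eta>\<^sup>2 * \<mu> / 2)"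
      by (simp add: c_def algebra_simps)
    show "0 \<le> \<phi> 1" unfolding \<phi>_def using lam by (intro sum_nonneg) auto
  qed
  finally show ?thesis
    by (simp add: S_def c_def N_def \<phi>_def Zpoly_def)
qed

text \<open>Given the part \<open>R\<close> outside \<open>C\<close>, only the set with nothing in
  \<open>C\<close> can be counted. Its conditional probability is the reciprocal of the partition
  function of the open part of \<open>C\<close>, which is at least \<open>M\<close> when
  \<open>P\<close> holds of that part.\<close>

lemma empty_class_bound:
  fixes lam M :: real
  assumes K: "finite K" and C: "C \<subseteq> K" and lam: "lam > 0" and M: "M > 0"
    and big: "\<And>R. R \<subseteq> C \<Longrightarrow> P R \<Longrightarrow> Zpoly R E lam \<ge> M"
  shows "(\<Sum>A\<in>indep_sets K E. if C \<inter> A = {} \<and> P (avail E C A) then lam ^ card A else 0)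
    \<le> 1 / M * Zpoly K E lam"
proof -
  have "(\<Sum>Q\<in>indep_sets (avail E C R) E.
        if C \<inter> (R \<union> Q) = {} \<and> P (avail E C (R \<union> Q)) then lam ^ card (R \<union> Q) else 0)
      \<le> 1 / M * (\<Sum>Q\<in>indep_sets (avail E C R) E. lam ^ card (R \<union> Q))"
    if R: "R \<in> indep_sets (K - C) E" for R
  proof -
    have finC: "finite C" using C K finite_subset by blast
    then have finav: "finite (avail E C R)" by (simp add: avail_def)
    have RC: "R \<subseteq> K - C" using R by (rule indep_setsD)
    then have finR: "finite R" using K finite_subset by blast
    have Q: "C \<inter> (R \<union> Q) = Q" "card (R \<union> Q) = card R + card Q"
      if "Q \<in> indep_sets (avail E C R) E" for Q
    proof -
      have 1: "Q \<subseteq> C" using indep_setsD [OF that] by (auto simp: avail_def)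
      then show "C \<inter> (R \<union> Q) = Q" using RC by auto
      show "card (R \<union> Q) = card R + card Q"
        using 1 finC finR RC by (intro card_Un_disjoint) (auto intro: finite_subset)
    qed
    have "(\<Sum>Q\<in>indep_sets (avail E C R) E.
        if C \<inter> (R \<union> Q) = {} \<and> P (avail E C (R \<union> Q)) then lam ^ card (R \<union> Q) else 0)
      = (\<Sum>Q\<in>indep_sets (avail E C R) E. if Q = {} then if P (avail E C R) then lam ^ card R else 0 else 0)"
      by (intro sum.cong) (auto simp: Q(1))
    also have "\<dots> = (if P (avail E C R) then lam ^ card R else 0)"
      using finav by (simp add: sum_indicator_empty)
    also have "\<dots> \<le> 1 / M * (lam ^ card R * Zpoly (avail E C R) E lam)"
    proof (cases "P (avail E C R)")
      case True
      then have "M \<le> Zpoly (avail E C R) E lam" by (intro big) (auto simp: avail_def)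
      then show ?thesis using True M lam by (simp add: field_simps)
    next
      case False
      then show ?thesis using M lam Zpoly_pos [OF finav lam, of E] by (simp add: less_imp_le)
    qed
    also have "lam ^ card R * Zpoly (avail E C R) E lam = (\<Sum>Q\<in>indep_sets (avail E C R) E. lam ^ card (R \<union> Q))"
      by (simp add: Zpoly_def sum_distrib_left Q(2) power_add)
    finally show ?thesis .
  qed
  then show ?thesis
    unfolding Zpoly_def sum_indep_sets_split [OF C K]
    by (subst sum_distrib_left) (intro sum_mono)
qed

subsection \<open>Independent transversals\<close>

text \<open>For a uniformly random \<open>f\<close>, a fixed \<open>x\<close> has at most 1/8
  expected conflicts with the choices elsewhere. The local lemma is applied with one event per
  conflicting pair, dependent on the pairs that share an index with it.\<close>

lemma sparse_independent_transversal:
  fixes A :: "'a \<Rightarrow> 'b set"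
  assumes U: "finite U" and A: "\<And>u. u \<in> U \<Longrightarrow> finite (A u) \<and> A u \<noteq> {}"
    and sparse: "\<And>u x. u \<in> U \<Longrightarrow> x \<in> A u \<Longrightarrow>
      (\<Sum>(v, y)\<in>{(v, y). v \<in> U - {u} \<and> y \<in> A v \<and> {x, y} \<in> E}. 1 / real (card (A v))) \<le> 1 / 8"
  shows "\<exists>f\<in>Pi\<^sub>E U A. \<forall>u\<in>U. \<forall>v\<in>U. u \<noteq> v \<longrightarrow> {f u, f v} \<notin> E"
proof -
  \<comment> \<open>Unordered pairs: counting each conflict once is what makes the bound \<open>1 / 8 + 1 / 8\<close> below suffice.\<close>
  define N where "N = {e. \<exists>u x v y. e = {(u, x), (v, y)} \<and> u \<in> U \<and> v \<in> U \<and> u \<noteq> v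
    \<and> x \<in> A u \<and> y \<in> A v \<and> {x, y} \<in> E}"
  define p where "p e = (\<Prod>(u, x)\<in>e. 1 / real (card (A u)))" for e :: "('a \<times> 'b) set"
  define \<Gamma> where "\<Gamma> e = {e' :: ('a \<times> 'b) set. fst ` e \<inter> fst ` e' \<noteq> {}}" for e :: "('a \<times> 'b) set"
  define B where "B e f \<longleftrightarrow> (\<forall>(u, x)\<in>e. f u = x)" for e :: "('a \<times> 'b) set" and f
  have fin\<Omega>: "finite (Pi\<^sub>E U A)" using U A by (intro finite_PiE) auto
  have finP: "finite (Sigma U A)" using U A by auto
  have "N \<subseteq> Pow (Sigma U A)" by (auto simp: N_def)
  then have finN: "finite N" using finP finite_subset by blast
  have p2: "p {(u, x), (v, y)} = 1 / real (card (A u)) * (1 / real (card (A v)))"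
    if "u \<noteq> v" for u x v y
    using that by (simp add: p_def)
  have p_nn: "0 \<le> p e" for e by (auto simp: p_def intro!: prod_nonneg)
  \<comment> \<open>The sparsity bound averaged over the uniform value at \<open>u\<close>:
    \<open>Y x\<close> holds the conflicts of \<open>x\<close>, and \<open>g\<close> maps them onto
    a superset of the events touching \<open>u\<close>.\<close>
  have touch: "sum p (N \<inter> {e. u \<in> fst ` e}) \<le> 1 / 8" if u: "u \<in> U" for u
  proof -
    define Y where "Y x = {(v, y). v \<in> U - {u} \<and> y \<in> A v \<and> {x, y} \<in> E}" for x
    define g where "g = (\<lambda>(x, b). {(u, x), b :: 'a \<times> 'b})"
    have finY: "finite (Y x)" for x
      by (rule finite_subset [OF _ finP]) (auto simp: Y_def)
    have "N \<inter> {e. u \<in> fst ` e} \<subseteq> g ` Sigma (A u) Y"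
    proof
      fix e assume "e \<in> N \<inter> {e. u \<in> fst ` e}"
      then obtain a x v y where e: "e = {(a, x), (v, y)}" "a \<in> U" "v \<in> U" "a \<noteq> v"
        "x \<in> A a" "y \<in> A v" "{x, y} \<in> E" "u = a \<or> u = v"
        by (auto simp: N_def)
      then have "e = g (x, (v, y)) \<and> (x, (v, y)) \<in> Sigma (A u) Y
          \<or> e = g (y, (a, x)) \<and> (y, (a, x)) \<in> Sigma (A u) Y"
        by (auto simp: g_def Y_def insert_commute)
      then show "e \<in> g ` Sigma (A u) Y" by blast
    qed
    then have "sum p (N \<inter> {e. u \<in> fst ` e}) \<le> sum p (g ` Sigma (A u) Y)"
      using A u finY p_nn by (intro sum_mono2) auto
    also have "\<dots> \<le> sum (p \<circ> g) (Sigma (A u) Y)"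
      using A u finY p_nn by (intro sum_image_le) auto
    also have "\<dots> = (\<Sum>x\<in>A u. \<Sum>b\<in>Y x. p (g (x, b)))"
      using A u finY by (subst sum.Sigma) (auto simp: case_prod_beta intro!: sum.cong)
    also have "\<dots> = (\<Sum>x\<in>A u. 1 / real (card (A u)) * (\<Sum>(v, y)\<in>Y x. 1 / real (card (A v))))"
      unfolding sum_distrib_left
      by (intro sum.cong refl) (auto simp: g_def Y_def p2)
    also have "\<dots> \<le> (\<Sum>x\<in>A u. 1 / real (card (A u)) * (1 / 8))"
      unfolding Y_def by (intro sum_mono mult_left_mono sparse [OF u]) auto
    also have "\<dots> \<le> 1 / 8" by simp
    finally show ?thesis .
  qed
  have \<Gamma>: "sum p (N \<inter> \<Gamma> e) \<le> 1 / 4" if "e \<in> N" for e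
  proof -
    obtain u x v y where e: "e = {(u, x), (v, y)}" "u \<in> U" "v \<in> U" using \<open>e \<in> N\<close> N_def by blast
    have "N \<inter> \<Gamma> e \<subseteq> (N \<inter> {e. u \<in> fst ` e}) \<union> (N \<inter> {e. v \<in> fst ` e})"
      by (auto simp: e \<Gamma>_def)
    then have "sum p (N \<inter> \<Gamma> e) \<le> sum p ((N \<inter> {e. u \<in> fst ` e}) \<union> (N \<inter> {e. v \<in> fst ` e}))"
      using finN p_nn by (intro sum_mono2) auto
    also have "\<dots> \<le> sum p (N \<inter> {e. u \<in> fst ` e}) + sum p (N \<inter> {e. v \<in> fst ` e})"
      using finN p_nn by (subst sum.union_inter [symmetric]) (auto intro!: sum_nonneg)
    finally show ?thesis using touch [OF e(2)] touch [OF e(3)] by linarith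
  qed
  have "\<exists>f\<in>Pi\<^sub>E U A. \<forall>e\<in>N. \<not> B e f"
  proof (rule lopsided_local_lemma [where w = "\<lambda>_. 1" and p = p and \<Gamma> = \<Gamma>])
    show "0 < (\<Sum>f\<in>Pi\<^sub>E U A. 1 :: real)"
      using A U fin\<Omega> by (simp add: card_gt_0_iff PiE_eq_empty_iff)
  next
    fix e assume e: "e \<in> N"
    \<comment> \<open>An event is its own neighbour here, so the neighbourhood sum also bounds its
      probability.\<close>
    then have "e \<in> N \<inter> \<Gamma> e" by (auto simp: N_def \<Gamma>_def)
    then have "p e \<le> sum p (N \<inter> \<Gamma> e)"
      using finN p_nn by (intro member_le_sum) auto
    with \<Gamma> [OF e] p_nn show "0 \<le> p e \<and> p e \<le> 1 / 4" by force
  next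
    fix e S assume e: "e \<in> N" and S: "S \<subseteq> N - \<Gamma> e"
    obtain u x v y where uv: "e = {(u, x), (v, y)}" "u \<in> U" "v \<in> U" "u \<noteq> v" "x \<in> A u" "y \<in> A v"
      using e N_def by blast
    let ?X = "{f \<in> Pi\<^sub>E U A. B e f \<and> (\<forall>j\<in>S. \<not> B j f)}"
    let ?Y = "{f \<in> Pi\<^sub>E U A. \<forall>j\<in>S. \<not> B j f}"
    \<comment> \<open>Resampling: \<open>B e f\<close> forces the values at \<open>u\<close> and
      \<open>v\<close>, so overwriting them by any pair \<open>a\<close>, \<open>b\<close> loses no
      information. The events in \<open>S\<close> touch neither index and remain avoided, and
      counting the images gives the factor \<open>p e\<close>.\<close>
    define h where "h = (\<lambda>(f, a, b). (f :: 'a \<Rightarrow> 'b)(u := a, v := b))"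
    have "inj_on h (?X \<times> A u \<times> A v)"
    proof (rule inj_onI)
      fix s t assume s: "s \<in> ?X \<times> A u \<times> A v" and t: "t \<in> ?X \<times> A u \<times> A v" and eq: "h s = h t"
      obtain f a b f' a' b' where [simp]: "s = (f, a, b)" "t = (f', a', b')" by (cases s, cases t) auto
      have eq': "(f(u := a, v := b)) z = (f'(u := a', v := b')) z" for z
        using eq by (simp add: h_def)
      have "f z = f' z" for z
        using eq' [of z] s t uv by (cases "z = u"; cases "z = v") (auto simp: B_def)
      moreover have "a = a'" "b = b'" using eq' [of u] eq' [of v] uv by auto
      ultimately show "s = t" by auto
    qed
    moreover have "h ` (?X \<times> A u \<times> A v) \<subseteq> ?Y"
    proof (rule image_subsetI)
      fix s assume "s \<in> ?X \<times> A u \<times> A v"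
      then obtain f a b where s: "s = (f, a, b)"
        and f: "f \<in> Pi\<^sub>E U A" "a \<in> A u" "b \<in> A v" "\<forall>j\<in>S. \<not> B j f"
        by auto
      have "h s \<in> Pi\<^sub>E U A"
        using f uv by (auto simp: s h_def PiE_iff extensional_def)
      moreover have "\<not> B j (h s)" if "j \<in> S" for j
      proof -
        have "u \<notin> fst ` j" "v \<notin> fst ` j" using S that uv by (auto simp: \<Gamma>_def)
        then have "B j (h s) \<longleftrightarrow> B j f"
          unfolding B_def h_def s by (intro ball_cong) (auto simp: rev_image_eqI)
        then show ?thesis using that f by blast
      qed
      ultimately show "h s \<in> ?Y" by blast
    qed
    ultimately have "card (?X \<times> A u \<times> A v) \<le> card ?Y"
      using fin\<Omega> by (intro card_inj_on_le) auto
    then have "real (card ?X) * (real (card (A u)) * real (card (A v))) \<le> real (card ?Y)"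
      by (simp add: card_cartesian_product flip: of_nat_mult)
    moreover have "0 < card (A u)" "0 < card (A v)" using A uv by (auto simp: card_gt_0_iff)
    ultimately show "(\<Sum>f\<in>?X. 1) \<le> p e * (\<Sum>f\<in>?Y. 1 :: real)"
      by (simp add: uv(1) p2 [OF uv(4)] field_simps)
  qed (use fin\<Omega> finN \<Gamma> in auto)
  then obtain f where f: "f \<in> Pi\<^sub>E U A" "\<forall>e\<in>N. \<not> B e f" by blast
  have "{f u, f v} \<notin> E" if "u \<in> U" "v \<in> U" "u \<noteq> v" for u v
  proof
    assume "{f u, f v} \<in> E"
    moreover have "f u \<in> A u" "f v \<in> A v" using that f by auto
    ultimately have "{(u, f u), (v, f v)} \<in> N" unfolding N_def using that by blast
    moreover have "B {(u, f u), (v, f v)} f" by (simp add: B_def)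
    ultimately show False using f by blast
  qed
  with f show ?thesis by blast
qed

subsection \<open>Covers of graphs\<close>

lemma indep_sets_image:
  assumes E: "\<And>x y. x \<in> R \<Longrightarrow> y \<in> R \<Longrightarrow> {\<pi> x, \<pi> y} \<in> F \<longleftrightarrow> {x, y} \<in> E"
  shows "indep_sets (\<pi> ` R) F = (`) \<pi> ` indep_sets R E"
proof (intro equalityI subsetI)
  fix I assume I: "I \<in> indep_sets (\<pi> ` R) F"
  then obtain J where J: "J \<subseteq> R" "I = \<pi> ` J" using indep_setsD subset_image_iff by metis
  have "J \<in> indep_sets R E"
    unfolding indep_sets_def indep_def using I J E
    by (auto simp: indep_sets_def indep_def subset_iff)
  with J show "I \<in> (`) \<pi> ` indep_sets R E" by blast
next
  fix I assume "I \<in> (`) \<pi> ` indep_sets R E"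
  then obtain J where "J \<in> indep_sets R E" "I = \<pi> ` J" by blast
  then show "I \<in> indep_sets (\<pi> ` R) F"
    using E by (auto simp: indep_sets_def indep_def subset_iff)
qed

text \<open>Stated for any function of the size, to transfer both \<open>Zpoly\<close> and
  \<open>Zpoly'\<close>.\<close>

lemma sum_indep_sets_image:
  assumes inj: "inj_on \<pi> R"
    and E: "\<And>x y. x \<in> R \<Longrightarrow> y \<in> R \<Longrightarrow> {\<pi> x, \<pi> y} \<in> F \<longleftrightarrow> {x, y} \<in> E"
  shows "(\<Sum>I\<in>indep_sets (\<pi> ` R) F. f (card I)) = (\<Sum>I\<in>indep_sets R E. f (card I))"
proof -
  have "inj_on ((`) \<pi>) (indep_sets R E)"
    by (rule inj_on_subset [OF inj_on_image_Pow [OF inj]]) (auto dest: indep_setsD)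
  then have "(\<Sum>I\<in>indep_sets (\<pi> ` R) F. f (card I)) = (\<Sum>I\<in>indep_sets R E. f (card (\<pi> ` I)))"
    using indep_sets_image [of R \<pi> F E] assms by (simp add: sum.reindex o_def)
  also have "\<dots> = (\<Sum>I\<in>indep_sets R E. f (card I))"
    using inj by (intro sum.cong refl arg_cong [of _ _ f] card_image)
      (auto intro: inj_on_subset dest: indep_setsD)
  finally show ?thesis .
qed

text \<open>Removing edges creates independent sets. This carries lower bounds for induced subgraphs
  over to the arbitrary subgraphs that general covers produce.\<close>

lemma Zpoly_antimono:
  assumes "finite S" "F' \<subseteq> F" "lam > 0"
  shows "Zpoly S F lam \<le> Zpoly S F' lam"
  unfolding Zpoly_def using assms
  by (intro sum_mono2) (auto simp: indep_sets_def indep_def intro: finite_subset [of _ "Pow S"])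

locale graph_cover =
  fixes V :: "'a set" and E :: "'a set set" and L :: "'a \<Rightarrow> 'c set"
    and VH :: "'c set" and EH :: "'c set set"
  assumes G: "graph V E" and cover: "is_cover V E L VH EH"
begin

lemma finite_V: "finite V" using G by (simp add: graph_def)

lemma finite_VH: "finite VH" using cover by (simp add: is_cover_def graph_def)

lemma L_subset: "u \<in> V \<Longrightarrow> L u \<subseteq> VH" using cover by (auto simp: is_cover_def)

lemma finite_L: "u \<in> V \<Longrightarrow> finite (L u)" using L_subset finite_VH finite_subset by blast

lemma L_cases: "y \<in> VH \<Longrightarrow> (\<And>v. v \<in> V \<Longrightarrow> y \<in> L v \<Longrightarrow> thesis) \<Longrightarrow> thesis"
  using cover by (auto simp: is_cover_def)

lemma L_unique:
  assumes "u \<in> V" "v \<in> V" "x \<in> L u" "x \<in> L v"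
  shows "u = v"
proof -
  have "\<forall>u\<in>V. \<forall>v\<in>V. u \<noteq> v \<longrightarrow> L u \<inter> L v = {}" using cover unfolding is_cover_def by (elim conjE)
  with assms show ?thesis by blast
qed

lemma L_complete:
  assumes "u \<in> V" "x \<in> L u" "y \<in> L u" "x \<noteq> y"
  shows "{x, y} \<in> EH"
proof -
  have "\<forall>u\<in>V. \<forall>x\<in>L u. \<forall>y\<in>L u. x \<noteq> y \<longrightarrow> {x, y} \<in> EH" using cover unfolding is_cover_def by (elim conjE)
  with assms show ?thesis by simp
qed

lemma EH_D: "{x, y} \<in> EH \<Longrightarrow> x \<in> VH \<and> y \<in> VH \<and> x \<noteq> y"
  using cover unfolding is_cover_def graph_def by (metis doubleton_eq_iff)

lemma EH_imp_E:
  assumes "u \<in> V" "v \<in> V" "u \<noteq> v" "x \<in> L u" "y \<in> L v" "{x, y} \<in> EH"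
  shows "{u, v} \<in> E"
proof -
  have "\<forall>u\<in>V. \<forall>v\<in>V. u \<noteq> v \<longrightarrow> (\<exists>x\<in>L u. \<exists>y\<in>L v. {x, y} \<in> EH) \<longrightarrow> {u, v} \<in> E"
    using cover unfolding is_cover_def by (elim conjE)
  with assms show ?thesis by (metis (no_types, lifting))
qed

lemma EH_matching:
  assumes "u \<in> V" "v \<in> V" "u \<noteq> v" "x \<in> L u" "y \<in> L v" "y' \<in> L v" "{x, y} \<in> EH" "{x, y'} \<in> EH"
  shows "y = y'"
proof -
  have "{u, v} \<in> E" using EH_imp_E assms by metis
  moreover have "\<forall>u\<in>V. \<forall>v\<in>V. {u, v} \<in> E \<longrightarrow>
        (\<forall>x\<in>L u. \<forall>y\<in>L v. \<forall>y'\<in>L v. {x, y} \<in> EH \<longrightarrow> {x, y'} \<in> EH \<longrightarrow> y = y')"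
    using cover unfolding is_cover_def by blast
  ultimately show ?thesis using assms by simp
qed

lemma not_in_nbhd_self: "u \<notin> nbhd V E u"
  using G unfolding graph_def nbhd_def by (metis (no_types, lifting) doubleton_eq_iff mem_Collect_eq)

lemma nbhd_sym: "u \<in> V \<Longrightarrow> v \<in> nbhd V E u \<Longrightarrow> u \<in> nbhd V E v"
  by (simp add: nbhd_def insert_commute)

lemma nbhd_subset: "nbhd V E u \<subseteq> V" by (auto simp: nbhd_def)

lemma finite_nbhd: "finite (nbhd V E u)" using nbhd_subset finite_V finite_subset by blast

lemma card_nbhd_le: "u \<in> V \<Longrightarrow> card (nbhd V E u) \<le> max_degree V E"
  unfolding max_degree_def using finite_V by (intro Max_ge) (auto simp: degree_def)

definition owner :: "'c \<Rightarrow> 'a" where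
  "owner y = (THE v. v \<in> V \<and> y \<in> L v)"

lemma owner_eq: "v \<in> V \<Longrightarrow> y \<in> L v \<Longrightarrow> owner y = v"
  unfolding owner_def using L_unique by blast

text \<open>The region of the cover graph on which the independent set is resampled for
  \<open>u\<close>.\<close>

definition nbhd_colours :: "'a \<Rightarrow> 'c set" where
  "nbhd_colours u = \<Union> (L ` nbhd V E u)"

lemma nbhd_coloursE:
  assumes "y \<in> nbhd_colours u"
  obtains v where "v \<in> nbhd V E u" "v \<in> V" "y \<in> L v" "owner y = v" "v \<noteq> u"
  using assms nbhd_subset owner_eq not_in_nbhd_self unfolding nbhd_colours_def by fastforce

lemma nbhd_colours_subset: "nbhd_colours u \<subseteq> VH"
  using L_subset by (auto elim!: nbhd_coloursE)

lemma finite_nbhd_colours: "finite (nbhd_colours u)"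
  using nbhd_colours_subset finite_VH finite_subset by blast

lemma nbhd_colours_disjoint: "u \<in> V \<Longrightarrow> nbhd_colours u \<inter> L u = {}"
  using L_unique by (auto elim!: nbhd_coloursE)

lemma neighbour_cases:
  assumes "u \<in> V" "x \<in> L u" "{x, z} \<in> EH"
  shows "z \<in> L u \<or> z \<in> nbhd_colours u"
proof -
  obtain v where "v \<in> V" "z \<in> L v" using EH_D [OF assms(3)] L_cases by blast
  then show ?thesis
    using EH_imp_E [of u v x z] assms by (cases "u = v") (auto simp: nbhd_colours_def nbhd_def)
qed

text \<open>Edges between two lists form a matching, so the neighbours of \<open>x\<close> in
  \<open>R\<close> lie in distinct lists and \<open>owner\<close> maps \<open>R\<close>
  isomorphically onto a subgraph of the neighbourhood of \<open>u\<close>. For a list cover all of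
  \<open>R\<close> has the colour of \<open>x\<close>, so every edge between owners lifts and the
  subgraph is induced.\<close>

lemma colour_neighbourhood_subgraph:
  assumes u: "u \<in> V" and x: "x \<in> L u" and R: "R \<subseteq> {y \<in> nbhd_colours u. {x, y} \<in> EH}"
  obtains S F where "S \<subseteq> nbhd V E u" "F \<subseteq> induced_edges E S" "card S = card R"
    "Zpoly S F lam = Zpoly R EH lam" "Zpoly' S F lam = Zpoly' R EH lam"
    "arises_from_lists V E L VH EH \<Longrightarrow> F = induced_edges E S"
proof -
  define S where "S = owner ` R"
  define F where "F = {{owner y, owner z} | y z. y \<in> R \<and> z \<in> R \<and> {y, z} \<in> EH}"
  have own: "owner y \<in> nbhd V E u" "owner y \<in> V" "y \<in> L (owner y)" "owner y \<noteq> u"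
      "{x, y} \<in> EH" "y \<in> VH"
    if "y \<in> R" for y
    using that R nbhd_colours_subset by (auto elim!: nbhd_coloursE)
  have inj: "inj_on owner R"
  proof (rule inj_onI)
    fix y z assume "y \<in> R" "z \<in> R" "owner y = owner z"
    then show "y = z" using own [of y] own [of z] EH_matching [OF u, of "owner y" x y z] x by auto
  qed
  have iff: "{owner y, owner z} \<in> F \<longleftrightarrow> {y, z} \<in> EH" if "y \<in> R" "z \<in> R" for y z
  proof
    assume "{owner y, owner z} \<in> F"
    then obtain a b where "a \<in> R" "b \<in> R" "{a, b} \<in> EH" "{owner y, owner z} = {owner a, owner b}"
      by (auto simp: F_def)
    then have "y = a \<and> z = b \<or> y = b \<and> z = a"
      using inj that by (auto simp: doubleton_eq_iff dest: inj_onD)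
    then show "{y, z} \<in> EH" using \<open>{a, b} \<in> EH\<close> by (auto simp: insert_commute)
  qed (use that in \<open>auto simp: F_def\<close>)
  have sub: "F \<subseteq> induced_edges E S"
  proof
    fix e assume "e \<in> F"
    then obtain y z where e: "e = {owner y, owner z}" "y \<in> R" "z \<in> R" "{y, z} \<in> EH"
      by (auto simp: F_def)
    then have "owner y \<noteq> owner z" using EH_D inj by (metis inj_onD)
    then have "e \<in> E"
      using EH_imp_E [of "owner y" "owner z" y z] e own [of y] own [of z] by simp
    then show "e \<in> induced_edges E S" using e by (auto simp: induced_edges_def S_def)
  qed
  have "induced_edges E S \<subseteq> F" if lists: "arises_from_lists V E L VH EH"
  proof
    obtain T \<phi> where \<phi>: "\<forall>u\<in>V. \<phi> ` L u = {u} \<times> (T u :: nat set)"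
      "\<forall>x\<in>VH. \<forall>y\<in>VH. fst (\<phi> x) \<noteq> fst (\<phi> y) \<longrightarrow>
           ({x, y} \<in> EH \<longleftrightarrow> {fst (\<phi> x), fst (\<phi> y)} \<in> E \<and> snd (\<phi> x) = snd (\<phi> y))"
      using lists unfolding arises_from_lists_def by blast
    have fst: "fst (\<phi> y) = v" if "v \<in> V" "y \<in> L v" for v y
    proof -
      have "\<phi> y \<in> {v} \<times> T v" using \<phi>(1) that by blast
      then show ?thesis by auto
    qed
    have snd: "snd (\<phi> y) = snd (\<phi> x)" if "y \<in> R" for y
    proof -
      have "x \<in> VH" using L_subset u x by blast
      then show ?thesis
        using \<phi>(2) own [OF that] fst [OF u x] fst [of "owner y" y] by simp
    qed
    fix e assume e: "e \<in> induced_edges E S"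
    then obtain a b where "e = {a, b}" "a \<noteq> b" "e \<subseteq> S" "e \<in> E"
      using G unfolding graph_def induced_edges_def by blast
    then obtain y z where yz: "y \<in> R" "z \<in> R" "owner y \<noteq> owner z" "e = {owner y, owner z}" "e \<in> E"
      by (auto simp: S_def)
    then have "{y, z} \<in> EH"
      using \<phi>(2) own [OF yz(1)] own [OF yz(2)] fst [of "owner y" y] fst [of "owner z" z]
        snd [OF yz(1)] snd [OF yz(2)] by simp
    then show "e \<in> F" using yz by (auto simp: F_def)
  qed
  moreover have "Zpoly S F lam = Zpoly R EH lam" "Zpoly' S F lam = Zpoly' R EH lam"
    unfolding Zpoly_def Zpoly'_def S_def
    using sum_indep_sets_image [OF inj iff, of "\<lambda>n. lam ^ n"]
      sum_indep_sets_image [OF inj iff, of "\<lambda>n. real n * lam ^ (n - 1)"] by auto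
  moreover have "S \<subseteq> nbhd V E u" "card S = card R"
    using own inj by (auto simp: S_def card_image)
  ultimately show ?thesis using sub that by blast
qed

section \<open>Free colours and bad vertices\<close>

text \<open>As lists are cliques, a vertex already coloured by \<open>I\<close> has no free
  colour.\<close>

definition free :: "'c set \<Rightarrow> 'c set" where
  "free I = {y \<in> VH - I. \<forall>z\<in>I. {y, z} \<notin> EH}"

text \<open>The two failures that obstruct completing \<open>I\<close> at an uncoloured vertex. The
  existential over \<open>v\<close> compares with the least \<open>ell v / 8\<close> in the
  neighbourhood; the 8 matches the sparsity bound for transversals.\<close>

definition bad :: "('a \<Rightarrow> real) \<Rightarrow> 'a \<Rightarrow> 'c set \<Rightarrow> bool" where
  "bad ell u I \<longleftrightarrow> I \<inter> L u = {} \<and>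
    (real (card (L u \<inter> free I)) < ell u \<or>
     (\<exists>x\<in>L u \<inter> free I. \<exists>v\<in>nbhd V E u.
        ell v / 8 < real (card {y \<in> free I - L u. {x, y} \<in> EH})))"

text \<open>Given \<open>J\<close>, the rest is a hard-core model on the open colours
  \<open>K\<close>. Having too few free colours has probability at most
  \<open>1 / (8 * \<Delta> ^ 3)\<close> by the lower tail; for each colour of \<open>u\<close>,
  being free with too many free neighbours has probability at most \<open>1 / M\<close>.\<close>

lemma bad_conditional_weight:
  assumes u: "u \<in> V" and lam: "lam > 0" and \<gamma>: "\<gamma> > 0" and \<alpha>: "\<alpha> > 0" and \<eta>: "0 < \<eta>" "\<eta> < 1"
    and occ: "\<And>x R. x \<in> L u \<Longrightarrow> R \<subseteq> {y \<in> nbhd_colours u. {x, y} \<in> EH} \<Longrightarrow>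
      Zpoly R EH lam \<le> \<alpha> + \<gamma> * (lam * Zpoly' R EH lam)"
    and Z: "\<And>x R v. x \<in> L u \<Longrightarrow> R \<subseteq> {y \<in> nbhd_colours u. {x, y} \<in> EH} \<Longrightarrow> v \<in> nbhd V E u \<Longrightarrow>
      ell v / 8 < real (card R) \<Longrightarrow> 8 * real (card (L u)) * real \<Delta> ^ 3 \<le> Zpoly R EH lam"
    and \<mu>: "\<mu> = (real (card (L u)) - \<gamma> * real (degree V E u)) / \<alpha>"
    and ell: "0 < ell u" "ell u \<le> (1 - \<eta>) * \<mu>"
    and \<Delta>: "1 \<le> \<Delta>" "6 * ln (2 * real \<Delta>) / \<eta>\<^sup>2 \<le> \<mu>"
    and J: "J \<in> indep_sets (VH - nbhd_colours u) EH"
  shows "(\<Sum>Q\<in>indep_sets (avail EH (nbhd_colours u) J) EH. if bad ell u (J \<union> Q) then lam ^ card (J \<union> Q) else 0)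
    \<le> 1 / (4 * real \<Delta> ^ 3) * (\<Sum>Q\<in>indep_sets (avail EH (nbhd_colours u) J) EH. lam ^ card (J \<union> Q))"
proof (cases "J \<inter> L u = {}")
  case False
  then have "\<not> bad ell u (J \<union> Q)" for Q by (auto simp: bad_def)
  then show ?thesis using lam by (simp add: sum_nonneg)
next
  case True
  define K where "K = avail EH (nbhd_colours u) J"
  define C where "C x = {y \<in> K. {x, y} \<in> EH}" for x
  have K: "K \<subseteq> nbhd_colours u" by (auto simp: K_def avail_def)
  then have finK: "finite K" using finite_nbhd_colours finite_subset by blast
  have Jsub: "J \<subseteq> VH - nbhd_colours u" using J by (rule indep_setsD)
  then have finJ: "finite J" using finite_VH finite_subset by blast
  have CK: "C x \<subseteq> K" and Cn: "C x \<subseteq> {y \<in> nbhd_colours u. {x, y} \<in> EH}" for x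
    using K by (auto simp: C_def)
  have "(1 - \<eta>) * \<mu> > 0" using ell by linarith
  then have \<mu>_pos: "\<mu> > 0" using \<eta> by (simp add: zero_less_mult_iff)
  then have "real (card (L u)) > \<gamma> * real (degree V E u)" using \<alpha> by (simp add: \<mu> zero_less_divide_iff)
  then have cardL: "real (card (L u)) > 0" using \<gamma> by (smt (verit) of_nat_0_le_iff mult_nonneg_nonneg)
  \<comment> \<open>A colour of another list is matched to at most one colour of
    \<open>L u\<close>.\<close>
  have C_disj: "C x \<inter> C y = {}" if "x \<in> L u" "y \<in> L u" "x \<noteq> y" for x y
  proof (rule ccontr)
    assume "C x \<inter> C y \<noteq> {}"
    then obtain z where z: "z \<in> nbhd_colours u" "{x, z} \<in> EH" "{y, z} \<in> EH" using K by (auto simp: C_def)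
    then obtain v where "v \<in> V" "z \<in> L v" "v \<noteq> u" by (auto elim: nbhd_coloursE)
    then show False
      using EH_matching [of v u z x y] z that u by (auto simp: insert_commute)
  qed
  \<comment> \<open>Lists are cliques, so \<open>A\<close> uses at most one colour per neighbour of
    \<open>u\<close>.\<close>
  have card_le: "card A \<le> degree V E u" if A: "A \<in> indep_sets K EH" for A
  proof -
    have "inj_on owner A"
    proof (rule inj_onI)
      fix y z assume yz: "y \<in> A" "z \<in> A" "owner y = owner z"
      then have "y \<in> nbhd_colours u" "z \<in> nbhd_colours u" using A K indep_setsD by blast+
      then have "{y, z} \<in> EH \<or> y = z"
        using yz L_complete by (metis nbhd_coloursE)
      then show "y = z" using A yz by (auto simp: indep_sets_def indep_def)
    qed
    moreover have "owner ` A \<subseteq> nbhd V E u"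
      using indep_setsD [OF A] K by (auto elim!: nbhd_coloursE)
    ultimately show ?thesis
      unfolding degree_def using finite_nbhd card_inj_on_le by blast
  qed
  have disjQ: "Q \<inter> L u = {}" if "Q \<in> indep_sets K EH" for Q
    using indep_setsD [OF that] K nbhd_colours_disjoint [OF u] by auto
  \<comment> \<open>Neighbours of \<open>x\<close> lie in \<open>L u\<close>, which neither
    \<open>J\<close> nor \<open>Q\<close> meets, or in the lists of neighbours of \<open>u\<close>,
    which \<open>J\<close> avoids.\<close>
  have freeL: "L u \<inter> free (J \<union> Q) = {x \<in> L u. C x \<inter> Q = {}}" if Q: "Q \<in> indep_sets K EH" for Q
  proof (intro equalityI subsetI)
    fix x assume "x \<in> L u \<inter> free (J \<union> Q)"
    then show "x \<in> {x \<in> L u. C x \<inter> Q = {}}" by (auto simp: free_def C_def)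
  next
    fix x assume x: "x \<in> {x \<in> L u. C x \<inter> Q = {}}"
    have "{x, z} \<notin> EH" if z: "z \<in> J \<union> Q" for z
    proof
      assume e: "{x, z} \<in> EH"
      then have "z \<in> nbhd_colours u"
        using neighbour_cases [OF u, of x z] x z True disjQ [OF Q] by auto
      then have "z \<in> Q" using z Jsub by auto
      then show False using x e indep_setsD [OF Q] by (auto simp: C_def)
    qed
    then show "x \<in> L u \<inter> free (J \<union> Q)"
      using x True disjQ [OF Q] L_subset [OF u] by (auto simp: free_def)
  qed
  have deg: "card {y \<in> free (J \<union> Q) - L u. {x, y} \<in> EH} \<le> card (avail EH (C x) Q)"
    if "x \<in> L u" for x Q
  proof (intro card_mono subsetI)
    show "finite (avail EH (C x) Q)" using finK by (auto simp: avail_def C_def)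
    fix y assume y: "y \<in> {y \<in> free (J \<union> Q) - L u. {x, y} \<in> EH}"
    then have "y \<in> nbhd_colours u" using neighbour_cases [OF u, of x y] that by auto
    then show "y \<in> avail EH (C x) Q"
      using y by (auto simp: avail_def C_def K_def free_def)
  qed
  let ?I = "indep_sets K EH"
  define P where "P R \<longleftrightarrow> (\<exists>v\<in>nbhd V E u. ell v / 8 < real (card R))" for R :: "'c set"
  define M where "M = 8 * real (card (L u)) * real \<Delta> ^ 3"
  have M: "M > 0" using cardL \<Delta> by (simp add: M_def)
  define few where "few Q \<longleftrightarrow> real (card {x \<in> L u. C x \<inter> Q = {}}) \<le> (1 - \<eta>) * \<mu>" for Q
  define crowded where "crowded x Q \<longleftrightarrow> C x \<inter> Q = {} \<and> P (avail EH (C x) Q)" for x Q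
  have bad_cases: "few Q \<or> (\<exists>x\<in>L u. crowded x Q)" if Q: "Q \<in> ?I" and b: "bad ell u (J \<union> Q)" for Q
  proof -
    consider "real (card (L u \<inter> free (J \<union> Q))) < ell u"
      | x v where "x \<in> L u \<inter> free (J \<union> Q)" "v \<in> nbhd V E u"
          "ell v / 8 < real (card {y \<in> free (J \<union> Q) - L u. {x, y} \<in> EH})"
      using b by (auto simp: bad_def)
    then show ?thesis
    proof cases
      case 1
      then show ?thesis using ell by (simp add: few_def freeL [OF Q])
    next
      case 2
      then have x: "x \<in> L u" "C x \<inter> Q = {}" using freeL [OF Q] by auto
      have "real (card {y \<in> free (J \<union> Q) - L u. {x, y} \<in> EH}) \<le> real (card (avail EH (C x) Q))"
        using deg [OF x(1)] by simp
      then have "P (avail EH (C x) Q)" using 2 unfolding P_def by force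
      then show ?thesis using x by (auto simp: crowded_def)
    qed
  qed
  have occ': "Zpoly R EH lam \<le> \<alpha> + \<gamma> * (lam * Zpoly' R EH lam)" if "x \<in> L u" "R \<subseteq> C x" for x R
    using occ [OF that(1) order_trans [OF that(2) Cn]] .
  have "(\<Sum>Q\<in>?I. if few Q then lam ^ card Q else 0) \<le> exp (- \<eta>\<^sup>2 * \<mu> / 2) * Zpoly K EH lam"
    unfolding few_def
    by (rule occupancy_lower_tail [OF finK finite_L [OF u] _ C_disj lam _ \<alpha> \<eta> _ card_le \<mu>])
      (use CK \<gamma> \<mu>_pos occ' in auto)
  also have "\<dots> \<le> 1 / (8 * real \<Delta> ^ 3) * Zpoly K EH lam"
  proof (intro mult_right_mono)
    \<comment> \<open>Source of the constant 6: \<open>\<eta>\<^sup>2 * \<mu> / 2\<close> is at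
      least \<open>3 * ln (2 * \<Delta>)\<close>, whose exponential is
      \<open>8 * \<Delta> ^ 3\<close>.\<close>
    have "6 * ln (2 * real \<Delta>) \<le> \<eta>\<^sup>2 * \<mu>" using \<Delta> \<eta> by (simp add: field_simps)
    then have "exp (- \<eta>\<^sup>2 * \<mu> / 2) \<le> exp (- (3 * ln (2 * real \<Delta>)))" by simp
    also have "\<dots> = 1 / (2 * real \<Delta>) ^ 3"
      using \<Delta> by (simp add: exp_minus exp_of_nat_mult [of 3, simplified] inverse_eq_divide)
    also have "\<dots> = 1 / (8 * real \<Delta> ^ 3)" by (simp add: power_mult_distrib)
    finally show "exp (- \<eta>\<^sup>2 * \<mu> / 2) \<le> 1 / (8 * real \<Delta> ^ 3)" .
  qed (use Zpoly_pos [OF finK lam, of EH] in simp)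
  finally have few: "(\<Sum>Q\<in>?I. if few Q then lam ^ card Q else 0) \<le> 1 / (8 * real \<Delta> ^ 3) * Zpoly K EH lam" .
  have crowded: "(\<Sum>Q\<in>?I. if crowded x Q then lam ^ card Q else 0) \<le> 1 / M * Zpoly K EH lam"
    if x: "x \<in> L u" for x
    unfolding crowded_def
  proof (rule empty_class_bound [OF finK CK lam M])
    fix R assume "R \<subseteq> C x" "P R"
    then show "M \<le> Zpoly R EH lam" using Z [OF x, of R] Cn [of x] by (auto simp: P_def M_def)
  qed
  have "(\<Sum>Q\<in>?I. if bad ell u (J \<union> Q) then lam ^ card Q else 0)
      \<le> (\<Sum>Q\<in>?I. (if few Q then lam ^ card Q else 0) + (\<Sum>x\<in>L u. if crowded x Q then lam ^ card Q else 0))"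
  proof (intro sum_mono)
    fix Q assume Q: "Q \<in> ?I"
    have nn: "0 \<le> (\<Sum>x\<in>L u. if crowded x Q then lam ^ card Q else 0)"
      using lam by (intro sum_nonneg) auto
    have "lam ^ card Q \<le> (\<Sum>x\<in>L u. if crowded x Q then lam ^ card Q else 0)" if "x \<in> L u" "crowded x Q" for x
      using member_le_sum [of x "L u" "\<lambda>x. if crowded x Q then lam ^ card Q else 0"] that lam finite_L [OF u]
      by auto
    then show "(if bad ell u (J \<union> Q) then lam ^ card Q else 0)
        \<le> (if few Q then lam ^ card Q else 0) + (\<Sum>x\<in>L u. if crowded x Q then lam ^ card Q else 0)"
      using bad_cases [OF Q] nn lam by (smt (verit) zero_le_power)
  qed
  also have "\<dots> = (\<Sum>Q\<in>?I. if few Q then lam ^ card Q else 0)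
      + (\<Sum>x\<in>L u. \<Sum>Q\<in>?I. if crowded x Q then lam ^ card Q else 0)"
    unfolding sum.distrib by (subst sum.swap) simp
  also have "\<dots> \<le> 1 / (8 * real \<Delta> ^ 3) * Zpoly K EH lam + (\<Sum>x\<in>L u. 1 / M * Zpoly K EH lam)"
    by (intro add_mono few sum_mono crowded)
  \<comment> \<open>The factor \<open>card (L u)\<close> in \<open>M\<close> absorbs the union over
    colours, leaving two equal shares.\<close>
  also have "\<dots> = 1 / (4 * real \<Delta> ^ 3) * Zpoly K EH lam"
    using cardL \<Delta> by (simp add: M_def field_simps)
  finally have main: "(\<Sum>Q\<in>?I. if bad ell u (J \<union> Q) then lam ^ card Q else 0)
      \<le> 1 / (4 * real \<Delta> ^ 3) * Zpoly K EH lam" .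
  have card: "lam ^ card (J \<union> Q) = lam ^ card J * lam ^ card Q" if "Q \<in> ?I" for Q
  proof -
    have "card (J \<union> Q) = card J + card Q"
      using indep_setsD [OF that] K Jsub finJ finK finite_subset by (intro card_Un_disjoint) blast+
    then show ?thesis by (simp add: power_add)
  qed
  have "(\<Sum>Q\<in>?I. if bad ell u (J \<union> Q) then lam ^ card (J \<union> Q) else 0)
      = lam ^ card J * (\<Sum>Q\<in>?I. if bad ell u (J \<union> Q) then lam ^ card Q else 0)"
    unfolding sum_distrib_left by (intro sum.cong) (auto simp: card)
  also have "\<dots> \<le> lam ^ card J * (1 / (4 * real \<Delta> ^ 3) * Zpoly K EH lam)"
    using lam by (intro mult_left_mono main) auto
  also have "\<dots> = 1 / (4 * real \<Delta> ^ 3) * (\<Sum>Q\<in>?I. lam ^ card (J \<union> Q))"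
    by (simp add: Zpoly_def card flip: sum_distrib_left)
  finally show ?thesis unfolding K_def .
qed

text \<open>\<open>I\<close> is resampled on the lists of \<open>N(u)\<close>, and \<open>bad ell v\<close> depends on \<open>I\<close> within distance 2 of \<open>v\<close>,
  so the lopsided dependencies of \<open>u\<close> are the vertices at distance at most 3.\<close>

definition near :: "'a \<Rightarrow> 'a set" where
  "near u = {v \<in> V - {u}. \<exists>w w'. (w = v \<or> w \<in> nbhd V E v) \<and> (w' = w \<or> w' \<in> nbhd V E w) \<and> w' \<in> nbhd V E u}"

text \<open>Counting only walks without backtracking keeps the bound at \<open>\<Delta> (1 + (\<Delta> - 1) \<Delta>) \<le> \<Delta>\<^sup>3\<close>.\<close>

lemma card_near:
  assumes u: "u \<in> V" and \<Delta>: "\<Delta> = max_degree V E" "1 \<le> \<Delta>"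
  shows "card (near u) \<le> \<Delta> ^ 3"
proof -
  let ?N = "nbhd V E"
  have rem: "card (?N v - {w}) \<le> \<Delta> - 1" if "v \<in> V" "w \<in> ?N v" for v w
    using that card_nbhd_le [of v] finite_nbhd \<Delta> by simp
  \<comment> \<open>For a walk \<open>u\<close>, \<open>v\<close>, \<open>w\<close>,
    \<open>z\<close>, the set \<open>W v w\<close> collects the ends reachable after
    \<open>v\<close> and \<open>w\<close>, and \<open>Y v\<close> those after \<open>v\<close>; the
    inserted elements are the shorter walks.\<close>
  define W where "W v w = insert w (?N w - {v})" for v w
  define Y where "Y v = insert v (\<Union>w\<in>?N v - {u}. W v w)" for v
  have "card (W v w) \<le> \<Delta>" if "v \<in> V" "w \<in> ?N v" for v w
  proof -
    have "card (W v w) \<le> Suc (card (?N w - {v}))" unfolding W_def by (rule card_insert_le_m1) simp_all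
    also have "card (?N w - {v}) \<le> \<Delta> - 1" using rem [of w v] that nbhd_subset nbhd_sym by blast
    finally show ?thesis using \<Delta> by simp
  qed
  then have W: "(\<Sum>w\<in>?N v - {u}. card (W v w)) \<le> card (?N v - {u}) * \<Delta>" if "v \<in> V" for v
    using that sum_bounded_above [of "?N v - {u}" "\<lambda>w. card (W v w)" \<Delta>] by simp
  have Y: "card (Y v) \<le> 1 + (\<Delta> - 1) * \<Delta>" if v: "v \<in> ?N u" for v
  proof -
    have "card (Y v) \<le> Suc (card (\<Union>w\<in>?N v - {u}. W v w))" unfolding Y_def by (rule card_insert_le_m1) simp_all
    also have "card (\<Union>w\<in>?N v - {u}. W v w) \<le> (\<Sum>w\<in>?N v - {u}. card (W v w))"
      using finite_nbhd by (intro card_UN_le) simp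
    also have "\<dots> \<le> card (?N v - {u}) * \<Delta>" using W v nbhd_subset by blast
    also have "\<dots> \<le> (\<Delta> - 1) * \<Delta>" using rem [of v u] v nbhd_subset nbhd_sym [OF u] by (intro mult_right_mono) auto
    finally show ?thesis by simp
  qed
  have fin: "finite (Y v)" for v using finite_nbhd by (auto simp: Y_def W_def)
  have "near u \<subseteq> (\<Union>v\<in>?N u. Y v)"
  proof
    fix z assume "z \<in> near u"
    then obtain w v where z: "z \<in> V" "z \<noteq> u" and w: "w = z \<or> w \<in> ?N z" and v: "v = w \<or> v \<in> ?N w" "v \<in> ?N u"
      by (auto simp: near_def)
    have "z \<in> ?N w" if "w \<noteq> z" using that w z nbhd_sym by blast
    moreover have "w \<in> ?N v" if "v \<noteq> w" using that v w z nbhd_sym nbhd_subset by blast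
    \<comment> \<open>A walk backtracking to \<open>u\<close> or \<open>v\<close> ends at a
      neighbour of \<open>u\<close>, covered as the inserted element of its own
      \<open>Y\<close>.\<close>
    ultimately consider "z = v" | "w = u" "z \<in> ?N u" | "w \<in> ?N v - {u}" "z = w \<or> z \<in> ?N w - {v}"
      | "z \<in> ?N v - {u}"
      using z by auto
    then show "z \<in> (\<Union>v\<in>?N u. Y v)"
      using v by cases (auto simp: Y_def W_def)
  qed
  then have "card (near u) \<le> card (\<Union>v\<in>?N u. Y v)"
    using fin finite_nbhd by (intro card_mono) auto
  also have "\<dots> \<le> (\<Sum>v\<in>?N u. card (Y v))" using finite_nbhd by (rule card_UN_le)
  also have "\<dots> \<le> card (?N u) * (1 + (\<Delta> - 1) * \<Delta>)"
    using sum_bounded_above [of "?N u" "\<lambda>v. card (Y v)" "1 + (\<Delta> - 1) * \<Delta>"] Y by simp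
  also have "\<dots> \<le> \<Delta> * (1 + (\<Delta> - 1) * \<Delta>)"
    unfolding \<Delta>(1) by (intro mult_right_mono card_nbhd_le [OF u]) simp
  also have "1 + (\<Delta> - 1) * \<Delta> \<le> \<Delta> * \<Delta>"
    using \<Delta>(2) by (auto simp: Suc_le_eq gr0_conv_Suc)
  finally show ?thesis by (simp add: power3_eq_cube)
qed

text \<open>Badness of \<open>v\<close> reads the colours of \<open>v\<close>, their neighbours, and
  the neighbours of those. If \<open>v\<close> is not near \<open>u\<close>, none of the lists
  involved belongs to a neighbour of \<open>u\<close>.\<close>

lemma bad_depends_locally:
  assumes u: "u \<in> V" and v: "v \<in> V" "v \<noteq> u" "v \<notin> near u"
  shows "bad ell v I \<longleftrightarrow> bad ell v (I - nbhd_colours u)"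
proof -
  let ?K = "nbhd_colours u"
  have far: "w' \<notin> nbhd V E u" if "w = v \<or> w \<in> nbhd V E v" "w' = w \<or> w' \<in> nbhd V E w" for w w'
    using that v by (auto simp: near_def)
  have LK: "L w' \<inter> ?K = {}" if "w = v \<or> w \<in> nbhd V E v" "w' = w \<or> w' \<in> nbhd V E w" for w w'
  proof -
    have "w' \<in> V" using that v nbhd_subset by blast
    then show ?thesis using far [OF that] L_unique [of w'] by (auto elim!: nbhd_coloursE)
  qed
  have free: "y \<in> free I \<longleftrightarrow> y \<in> free (I - ?K)" if w: "w = v \<or> w \<in> nbhd V E v" and y: "y \<in> L w" for w y
  proof -
    have wV: "w \<in> V" using w v nbhd_subset by blast
    have "z \<notin> ?K" if "{y, z} \<in> EH" for z
      using neighbour_cases [OF wV y that] LK [OF w] unfolding nbhd_colours_def by blast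
    moreover have "y \<notin> ?K" using LK [OF w] y by blast
    ultimately show ?thesis by (auto simp: free_def)
  qed
  have "I \<inter> L v = {} \<longleftrightarrow> (I - ?K) \<inter> L v = {}" using LK [of v v] by blast
  moreover have "L v \<inter> free I = L v \<inter> free (I - ?K)" using free [of v] by blast
  moreover have "{y \<in> free I - L v. {x, y} \<in> EH} = {y \<in> free (I - ?K) - L v. {x, y} \<in> EH}"
    if x: "x \<in> L v" for x
  proof -
    have "y \<in> free I \<longleftrightarrow> y \<in> free (I - ?K)" if "{x, y} \<in> EH" for y
      using neighbour_cases [OF v(1) x that] free unfolding nbhd_colours_def by blast
    then show ?thesis by blast
  qed
  ultimately show ?thesis unfolding bad_def by (metis (no_types, lifting) IntD1)
qed

section \<open>From an independent set to a colouring\<close>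

text \<open>Lists are cliques, so \<open>T\<close> has exactly one colour in each and
  \<open>owner\<close> is a bijection onto \<open>V\<close>.\<close>

lemma colouring_if_meets_all:
  assumes T: "indep VH EH T" and meets: "\<And>v. v \<in> V \<Longrightarrow> T \<inter> L v \<noteq> {}"
  shows "has_cover_colouring V L VH EH"
proof -
  have TVH: "T \<subseteq> VH" using T by (simp add: indep_def)
  have own: "owner y \<in> V \<and> y \<in> L (owner y)" if "y \<in> T" for y
  proof -
    obtain v where "v \<in> V" "y \<in> L v" using \<open>y \<in> T\<close> TVH by (auto elim: L_cases)
    then show ?thesis using owner_eq by simp
  qed
  have "bij_betw owner T V"
    unfolding bij_betw_def
  proof
    show "inj_on owner T"
    proof (rule inj_onI)
      fix y z assume "y \<in> T" "z \<in> T" "owner y = owner z"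
      then show "y = z" using own L_complete T unfolding indep_def by metis
    qed
    show "owner ` T = V"
    proof (intro equalityI subsetI)
      fix v assume "v \<in> V"
      then show "v \<in> owner ` T" using meets owner_eq by blast
    qed (use own in auto)
  qed
  then have "card T = card V" by (rule bij_betw_same_card)
  then show ?thesis unfolding has_cover_colouring_def using T by blast
qed

text \<open>Each uncoloured \<open>v\<close> has at least \<open>ell v\<close> free colours, while a
  free colour of \<open>u\<close> has at most \<open>ell v / 8\<close> free neighbours outside
  \<open>L u\<close>, for every neighbour \<open>v\<close> of \<open>u\<close>. Hence its conflicts
  weigh at most 1/8 in total, and an independent transversal of the free colours completes
  \<open>I\<close>.\<close>

lemma colouring_if_no_bad:
  assumes I: "indep VH EH I" and good: "\<And>u. u \<in> V \<Longrightarrow> \<not> bad ell u I"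
    and ell: "\<And>u. u \<in> V \<Longrightarrow> ell u > 0"
  shows "has_cover_colouring V L VH EH"
proof -
  define U where "U = {u \<in> V. I \<inter> L u = {}}"
  define A where "A u = L u \<inter> free I" for u
  define T where "T u x = {y \<in> free I - L u. {x, y} \<in> EH}" for u x
  have finT: "finite (T u x)" for u x using finite_VH by (auto simp: T_def free_def)
  have finA: "finite (A u)" if "u \<in> U" for u using that finite_L by (auto simp: U_def A_def)
  have big: "ell u \<le> real (card (A u))" if "u \<in> U" for u
    using good [of u] that by (auto simp: bad_def U_def A_def)
  have small: "real (card (T u x)) \<le> ell v / 8" if "u \<in> U" "x \<in> A u" "v \<in> nbhd V E u" for u x v
    using good [of u] that by (force simp: bad_def U_def A_def T_def)
  have "\<exists>f\<in>Pi\<^sub>E U A. \<forall>u\<in>U. \<forall>v\<in>U. u \<noteq> v \<longrightarrow> {f u, f v} \<notin> EH"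
  proof (rule sparse_independent_transversal)
    show "finite U" using finite_V by (simp add: U_def)
    show "finite (A u) \<and> A u \<noteq> {}" if "u \<in> U" for u
      using that finA big [OF that] ell [of u] by (auto simp: U_def)
    fix u x assume u: "u \<in> U" and x: "x \<in> A u"
    define Y where "Y = {(v, y). v \<in> U - {u} \<and> y \<in> A v \<and> {x, y} \<in> EH}"
    define c where "c = real (card (T u x))"
    have YT: "y \<in> T u x" and Yn: "v \<in> nbhd V E u" and YU: "v \<in> U" if "(v, y) \<in> Y" for v y
      using that u x EH_imp_E [of u v x y] L_unique [of u v y]
      by (auto simp: Y_def U_def A_def T_def nbhd_def)
    have "inj_on snd Y"
      by (rule inj_onI) (auto simp: Y_def U_def A_def dest: L_unique)
    then have cY: "card Y \<le> card (T u x)"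
      using YT finT by (intro card_inj_on_le) auto
    have "1 / real (card (A v)) \<le> 1 / (8 * c)" if "(v, y) \<in> Y" for v y
    proof -
      have "c > 0" using YT [OF that] finT by (auto simp: c_def card_gt_0_iff)
      moreover have "8 * c \<le> real (card (A v))"
        using small [OF u x Yn [OF that]] big [OF YU [OF that]] by (simp add: c_def)
      ultimately show ?thesis by (intro divide_left_mono) auto
    qed
    then have "(\<Sum>(v, y)\<in>Y. 1 / real (card (A v))) \<le> (\<Sum>b\<in>Y. 1 / (8 * c))"
      by (intro sum_mono) auto
    also have "\<dots> = real (card Y) / (8 * c)" by simp
    also have "\<dots> \<le> c / (8 * c)" using cY by (intro divide_right_mono) (auto simp: c_def)
    \<comment> \<open>For \<open>c = 0\<close> the quotient is 0, by the convention for division by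
      zero.\<close>
    also have "\<dots> \<le> 1 / 8" by simp
    finally show "(\<Sum>(v, y)\<in>{(v, y). v \<in> U - {u} \<and> y \<in> A v \<and> {x, y} \<in> EH}. 1 / real (card (A v))) \<le> 1 / 8"
      unfolding Y_def .
  qed
  then obtain f where f: "f \<in> Pi\<^sub>E U A" "\<And>u v. u \<in> U \<Longrightarrow> v \<in> U \<Longrightarrow> u \<noteq> v \<Longrightarrow> {f u, f v} \<notin> EH"
    by blast
  have fA: "f u \<in> L u" "f u \<in> free I" if "u \<in> U" for u using f that by (auto simp: A_def)
  show ?thesis
  proof (rule colouring_if_meets_all)
    show "indep VH EH (I \<union> f ` U)"
      unfolding indep_def
    proof (intro conjI ballI)
      show "I \<union> f ` U \<subseteq> VH" using I fA by (auto simp: indep_def free_def)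
      have *: "{f u, z} \<notin> EH" "{z, f u} \<notin> EH" if "u \<in> U" "z \<in> I" for u z
        using fA(2) [OF that(1)] that(2) by (auto simp: free_def insert_commute)
      have **: "{f u, f v} \<notin> EH" if "u \<in> U" "v \<in> U" for u v
        using f(2) that EH_D by (cases "u = v") blast+
      fix y z assume "y \<in> I \<union> f ` U" "z \<in> I \<union> f ` U"
      then show "{y, z} \<notin> EH" using * ** I unfolding indep_def by blast
    qed
    show "(I \<union> f ` U) \<inter> L v \<noteq> {}" if "v \<in> V" for v
      using that fA by (cases "v \<in> U") (auto simp: U_def)
  qed
qed

text \<open>The local lemma for the hard-core measure on the cover graph, with
  \<open>p = 1 / (4 * \<Delta> ^ 3)\<close> and at most \<open>\<Delta> ^ 3\<close> near vertices.
  Fixing the part \<open>J\<close> outside the lists of neighbours of \<open>u\<close> decides every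
  event away from \<open>near u\<close>, while \<open>rare\<close> still bounds the event at
  \<open>u\<close>; this is the lopsided condition.\<close>

lemma colouring_if_bad_rare:
  fixes lam :: real
  assumes lam: "lam > 0" and \<Delta>: "\<Delta> = max_degree V E" "1 \<le> \<Delta>"
    and ell: "\<And>u. u \<in> V \<Longrightarrow> ell u > 0"
    and rare: "\<And>u J. u \<in> V \<Longrightarrow> J \<in> indep_sets (VH - nbhd_colours u) EH \<Longrightarrow>
      (\<Sum>Q\<in>indep_sets (avail EH (nbhd_colours u) J) EH. if bad ell u (J \<union> Q) then lam ^ card (J \<union> Q) else 0)
      \<le> 1 / (4 * real \<Delta> ^ 3) * (\<Sum>Q\<in>indep_sets (avail EH (nbhd_colours u) J) EH. lam ^ card (J \<union> Q))"
  shows "has_cover_colouring V L VH EH"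
proof -
  define p where "p = 1 / (4 * real \<Delta> ^ 3)"
  let ?\<Omega> = "indep_sets VH EH"
  let ?w = "\<lambda>I. lam ^ card I"
  have D1: "1 \<le> real \<Delta> ^ 3" using \<Delta>(2) by simp
  have "\<exists>I\<in>?\<Omega>. \<forall>u\<in>V. \<not> bad ell u I"
  proof (rule lopsided_local_lemma [where w = ?w and p = "\<lambda>_. p" and \<Gamma> = near])
    show "finite ?\<Omega>" using finite_VH by simp
    show "finite V" by (rule finite_V)
    show "0 \<le> ?w I" for I :: "'c set" using lam by simp
    show "0 < sum ?w ?\<Omega>" using Zpoly_pos [OF finite_VH lam] by (simp add: Zpoly_def)
    show "0 \<le> p \<and> p \<le> 1 / 4" using D1 by (simp add: p_def divide_simps)
  next
    fix u assume u: "u \<in> V"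
    have "card (V \<inter> near u) \<le> card (near u)"
      using finite_V by (intro card_mono) (auto simp: near_def)
    also have "\<dots> \<le> \<Delta> ^ 3" by (rule card_near [OF u \<Delta>])
    finally have "real (card (V \<inter> near u)) \<le> real \<Delta> ^ 3"
      by (metis of_nat_le_iff of_nat_power)
    then show "(\<Sum>v\<in>V \<inter> near u. p) \<le> 1 / 4" using D1 by (simp add: p_def divide_simps)
  next
    fix u S assume u: "u \<in> V" and S: "S \<subseteq> V - near u" "u \<notin> S"
    let ?K = "nbhd_colours u"
    let ?av = "avail EH ?K"
    define ok where "ok I \<longleftrightarrow> (\<forall>v\<in>S. \<not> bad ell v I)" for I
    have ok: "ok (J \<union> Q) \<longleftrightarrow> ok J" if "J \<in> indep_sets (VH - ?K) EH" "Q \<in> indep_sets (?av J) EH" for J Q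
    proof -
      have "J \<union> Q - ?K = J"
        using indep_setsD [OF that(1)] indep_setsD [OF that(2)] by (auto simp: avail_def)
      then have "bad ell v (J \<union> Q) \<longleftrightarrow> bad ell v J" if "v \<in> S" for v
        using bad_depends_locally [OF u, of v ell "J \<union> Q"] that S by auto
      then show ?thesis by (simp add: ok_def)
    qed
    have fin: "finite ?\<Omega>" using finite_VH by simp
    have "sum ?w {I \<in> ?\<Omega>. bad ell u I \<and> ok I} = (\<Sum>I\<in>?\<Omega>. if bad ell u I \<and> ok I then ?w I else 0)"
      by (rule sum.inter_filter [OF fin])
    also have "\<dots> = (\<Sum>J\<in>indep_sets (VH - ?K) EH. \<Sum>Q\<in>indep_sets (?av J) EH.
        if bad ell u (J \<union> Q) \<and> ok (J \<union> Q) then ?w (J \<union> Q) else 0)"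
      by (rule sum_indep_sets_split [OF nbhd_colours_subset finite_VH])
    also have "\<dots> \<le> (\<Sum>J\<in>indep_sets (VH - ?K) EH. p * (\<Sum>Q\<in>indep_sets (?av J) EH.
        if ok (J \<union> Q) then ?w (J \<union> Q) else 0))"
    proof (rule sum_mono)
      fix J assume J: "J \<in> indep_sets (VH - ?K) EH"
      show "(\<Sum>Q\<in>indep_sets (?av J) EH. if bad ell u (J \<union> Q) \<and> ok (J \<union> Q) then ?w (J \<union> Q) else 0)
          \<le> p * (\<Sum>Q\<in>indep_sets (?av J) EH. if ok (J \<union> Q) then ?w (J \<union> Q) else 0)"
        \<comment> \<open>If \<open>ok J\<close> fails both sums vanish; otherwise the claim is
          \<open>rare\<close>.\<close>
        using rare [OF u J] ok [OF J] unfolding p_def [symmetric]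
        by (cases "ok J") (simp_all cong: sum.cong)
    qed
    also have "\<dots> = p * (\<Sum>I\<in>?\<Omega>. if ok I then ?w I else 0)"
      unfolding sum_distrib_left [symmetric]
      by (subst sum_indep_sets_split [where C = ?K, OF nbhd_colours_subset finite_VH, where f = "\<lambda>I. if ok I then ?w I else 0"]) (rule refl)
    also have "(\<Sum>I\<in>?\<Omega>. if ok I then ?w I else 0) = sum ?w {I \<in> ?\<Omega>. ok I}"
      by (rule sum.inter_filter [OF fin, symmetric])
    finally show "sum ?w {I \<in> ?\<Omega>. bad ell u I \<and> (\<forall>v\<in>S. \<not> bad ell v I)}
        \<le> p * sum ?w {I \<in> ?\<Omega>. \<forall>v\<in>S. \<not> bad ell v I}"
      unfolding ok_def .
  qed
  then show ?thesis
    using colouring_if_no_bad [where ell = ell] ell by (auto simp: indep_sets_def)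
qed

text \<open>No edge joins two different lists, so any choice of one colour per list is
  independent.\<close>

lemma colouring_if_edgeless:
  assumes "max_degree V E = 0" and "\<And>u. u \<in> V \<Longrightarrow> L u \<noteq> {}"
  shows "has_cover_colouring V L VH EH"
proof -
  define f where "f u = (SOME x. x \<in> L u)" for u
  have f: "f u \<in> L u" if "u \<in> V" for u
    using assms(2) [OF that] by (simp add: f_def some_in_eq)
  have "{f u, f v} \<notin> EH" if "u \<in> V" "v \<in> V" for u v
  proof
    assume e: "{f u, f v} \<in> EH"
    then have "u \<noteq> v" using EH_D by blast
    then have "v \<in> nbhd V E u" using EH_imp_E [of u v "f u" "f v"] e f that by (auto simp: nbhd_def)
    moreover have "nbhd V E u = {}" using card_nbhd_le [of u] that assms(1) finite_nbhd by simp
    ultimately show False by blast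
  qed
  then show ?thesis
    using f subsetD [OF L_subset f] by (intro colouring_if_meets_all [of "f ` V"]) (auto simp: indep_def)
qed

end

section \<open>Transfer of the hypotheses from the graph to its cover\<close>

theorem mainTheorem3:
  fixes V :: "'a set" and E :: "'a set set" and lam :: real
    and \<beta> \<gamma> ell \<eta> :: "'a \<Rightarrow> real"
    and L :: "'a \<Rightarrow> 'c set" and VH :: "'c set" and EH :: "'c set set"
  assumes G: "graph V E"
    and lam_pos: "lam > 0"
    and pos: "\<forall>u\<in>V. \<beta> u > 0 \<and> \<gamma> u > 0 \<and> ell u > 0 \<and> \<eta> u > 0 \<and> \<eta> u < 1"
    and cover: "is_cover V E L VH EH"
    and occ: "(local_occupancy V E lam \<beta> \<gamma> \<and> arises_from_lists V E L VH EH)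
              \<or> strong_local_occupancy V E lam \<beta> \<gamma>"
    and list_size: "\<forall>u\<in>V. (1 + lam) / (\<beta> u * lam) * (real (card (L u)) - \<gamma> u * real (degree V E u))
                       \<ge> max (ell u / (1 - \<eta> u)) (6 * ln (2 * real (max_degree V E)) / (\<eta> u)^2)"
    and Z_large: "\<forall>u\<in>V. \<forall>S. S \<subseteq> nbhd V E u \<longrightarrow> nbhd V E u \<noteq> {} \<longrightarrow>
                    real (card S) > Min (ell ` nbhd V E u) / 8 \<longrightarrow>
                    Zpoly S (induced_edges E S) lam \<ge> 8 * real (card (L u)) * real (max_degree V E) ^ 3"
  shows "has_cover_colouring V L VH EH"
proof -
  interpret graph_cover V E L VH EH by unfold_locales (rule G, rule cover)
  \<comment> \<open>Multiplying the occupancy inequality by the partition function gives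
    \<open>Z \<le> \<alpha> + \<gamma> * \<lambda> * Z'\<close>. With this \<open>\<alpha>\<close>,
    \<open>\<mu> u\<close> is the bounded quantity in \<open>list_size\<close>.\<close>
  define \<alpha> where "\<alpha> u = \<beta> u * (lam / (1 + lam))" for u
  define \<mu> where "\<mu> u = (real (card (L u)) - \<gamma> u * real (degree V E u)) / \<alpha> u" for u
  have \<alpha>: "\<alpha> u > 0" if "u \<in> V" for u using pos that lam_pos by (simp add: \<alpha>_def)
  have "\<mu> u = (1 + lam) / (\<beta> u * lam) * (real (card (L u)) - \<gamma> u * real (degree V E u))" for u
    by (simp add: \<mu>_def \<alpha>_def)
  then have \<mu>: "ell u / (1 - \<eta> u) \<le> \<mu> u" "6 * ln (2 * real (max_degree V E)) / (\<eta> u)\<^sup>2 \<le> \<mu> u"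
    if "u \<in> V" for u
    using list_size that by auto
  show ?thesis
  proof (cases "max_degree V E = 0")
    \<comment> \<open>The failure bound \<open>1 / (4 * \<Delta> ^ 3)\<close> degenerates at
      \<open>\<Delta> = 0\<close>, so this case is separate:
      \<open>0 < ell u / (1 - \<eta> u) \<le> \<mu> u\<close> makes every list nonempty.\<close>
    case True
    have "L u \<noteq> {}" if u: "u \<in> V" for u
    proof
      assume "L u = {}"
      then have "\<mu> u \<le> 0" using pos u \<alpha> [OF u] by (simp add: \<mu>_def less_imp_le)
      moreover have "0 < ell u / (1 - \<eta> u)" using pos u by simp
      ultimately show False using \<mu>(1) [OF u] by linarith
    qed
    with True show ?thesis by (rule colouring_if_edgeless)
  next
    case False
    then have \<Delta>: "1 \<le> max_degree V E" by simp
    show ?thesis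
    proof (rule colouring_if_bad_rare [OF lam_pos refl \<Delta>])
      fix u J assume u: "u \<in> V" and J: "J \<in> indep_sets (VH - nbhd_colours u) EH"
      have P: "\<beta> u > 0" "\<gamma> u > 0" "ell u > 0" "\<eta> u > 0" "\<eta> u < 1" using pos u by auto
      show "(\<Sum>Q\<in>indep_sets (avail EH (nbhd_colours u) J) EH. if bad ell u (J \<union> Q) then lam ^ card (J \<union> Q) else 0)
        \<le> 1 / (4 * real (max_degree V E) ^ 3) * (\<Sum>Q\<in>indep_sets (avail EH (nbhd_colours u) J) EH. lam ^ card (J \<union> Q))"
      proof (rule bad_conditional_weight [where ell = ell, OF u lam_pos P(2) \<alpha> [OF u] P(4,5) _ _ \<mu>_def P(3) _ \<Delta> \<mu>(2) [OF u] J])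
        show "ell u \<le> (1 - \<eta> u) * \<mu> u" using \<mu>(1) [OF u] P by (simp add: field_simps)
      next
        fix x R assume x: "x \<in> L u" and R: "R \<subseteq> {y \<in> nbhd_colours u. {x, y} \<in> EH}"
        obtain S F where SF: "S \<subseteq> nbhd V E u" "F \<subseteq> induced_edges E S"
          "Zpoly S F lam = Zpoly R EH lam" "Zpoly' S F lam = Zpoly' R EH lam"
          "arises_from_lists V E L VH EH \<Longrightarrow> F = induced_edges E S"
          using colour_neighbourhood_subgraph [OF u x R, of lam] by metis
        \<comment> \<open>For a list cover \<open>F\<close> is induced, so local occupancy applies;
          strong local occupancy covers every \<open>F\<close>.\<close>
        have "occ_ineq lam (\<beta> u) (\<gamma> u) S F"
          using occ SF u unfolding local_occupancy_def strong_local_occupancy_def by metis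
        moreover have "Zpoly R EH lam > 0"
          using R finite_nbhd_colours lam_pos by (intro Zpoly_pos) (auto intro: finite_subset)
        ultimately show "Zpoly R EH lam \<le> \<alpha> u + \<gamma> u * (lam * Zpoly' R EH lam)"
          unfolding occ_ineq_def SF \<alpha>_def by (simp add: divide_simps split: if_splits)
      next
        fix x R v assume x: "x \<in> L u" and R: "R \<subseteq> {y \<in> nbhd_colours u. {x, y} \<in> EH}"
          and v: "v \<in> nbhd V E u" "ell v / 8 < real (card R)"
        obtain S F where SF: "S \<subseteq> nbhd V E u" "F \<subseteq> induced_edges E S" "card S = card R"
          "Zpoly S F lam = Zpoly R EH lam"
          using colour_neighbourhood_subgraph [OF u x R, of lam] by metis
        have "Min (ell ` nbhd V E u) \<le> ell v" using v finite_nbhd by (intro Min_le) auto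
        then have "Min (ell ` nbhd V E u) / 8 < real (card S)" using v SF by simp
        \<comment> \<open>\<open>Z_large\<close> concerns the induced graph on \<open>S\<close>;
          \<open>F\<close> has no further edges, so its partition function is at least as
          large.\<close>
        then have "8 * real (card (L u)) * real (max_degree V E) ^ 3 \<le> Zpoly S (induced_edges E S) lam"
          using Z_large u SF(1) v(1) by blast
        also have "\<dots> \<le> Zpoly S F lam"
          using SF finite_nbhd lam_pos by (intro Zpoly_antimono) (auto intro: finite_subset)
        finally show "8 * real (card (L u)) * real (max_degree V E) ^ 3 \<le> Zpoly R EH lam"
          using SF by simp
      qed
    qed (use pos in auto)
  qed
qed

end
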